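(* Let $\lambda_0\in S^1$ and let $f(\cdot,\lambda_0):\mathbb{C}\to\mathbb{C}P^2$ be the translationally equivariant minimal Lagrangian immersion generated by $D(\lambda)dz$, at the fixed value $\lambda=\lambda_0$. For translations $\omega=p+m2Ti$ with $p\in\mathbb{R}$, $m\in\mathbb{Z}$, there are two natural cases: (1) Real translations: if $m=0$, then $f(z,\lambda_0)$ is an equivariant cylinder if and only if $d_1(\lambda_0)/d_2(\lambda_0)$ is rational. (2) Purely imaginary translations: if $p=0$, then $f(z,\lambda_0)$ is an equivariant cylinder if and only if $$\mathrm{Re}\,\beta_1(2T,\lambda_0)\,d_j(\lambda_0)+\mathrm{Im}\,\beta_2(2T,\lambda_0)\left(-d_j(\lambda_0)^2+\frac{2\beta}{3}\right)=2\pi r_j,$$ where $r_j$ ($j=1,2$) are rational numbers.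
   Context: $f(\cdot,\lambda_0)$ is called an equivariant cylinder if $f(z+\omega,\lambda_0)=f(z,\lambda_0)$ for all $z$ for some period $\omega$; in (1) this means for some nonzero real $\omega=p$, in (2) for some $\omega=m2Ti$ with $m$ a nonzero integer. $z=x+iy$, $'=d/dy$. Surfaces are assumed not totally geodesic and non-flat. Let $\psi\in\mathbb{C}\setminus\{0\}$ and let $u=u(y)$ be a non-constant real solution of $\frac14u''+e^u-|\psi|^2e^{-2u}=0$ with $u'(0)=0$ and $u(0)=\max u$; $u$ is even and periodic, with smallest period $2T$. Put $a=ie^{u(0)/2}$, $b=i\psi/a^2$, $\beta=2|a|^2+|b|^2$, and $$D(\lambda)=\begin{pmatrix}0&-\lambda\bar b&\lambda^{-1}a\\ \lambda^{-1}b&0&-\lambda\bar a\\ -\lambda\bar a&\lambda^{-1}a&0\end{pmatrix}.$$ For $\lambda\in S^1$ let $id_1(\lambda),id_2(\lambda),id_3(\lambda)$ ($d_j$ real) be the eigenvalues of $D(\lambda)$, i.e. the roots of $\mu^3+\beta\mu-2i\mathrm{Re}(\lambda^{-3}\psi)$. Put $$\beta_1(y,\lambda)=\int_0^y\frac{2i\lambda^3\bar\psi-iu'e^u}{\lambda^3\bar\psi-\lambda^{-3}\psi-e^uu'}ds,\qquad\beta_2(y,\lambda)=\int_0^y\frac{2e^u}{\lambda^3\bar\psi-\lambda^{-3}\psi-e^uu'}ds.$$ The immersion generated by $D(\lambda)dz$ is $f(z,\lambda)=[\mathbb{F}(z,\lambda)e_3]$, where $\mathbb{F}(z,\lambda)\in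 SU(3)$ is the solution with $\mathbb{F}(0,\lambda)=I$ of $$\mathbb{F}^{-1}\mathbb{F}_z=\lambda^{-1}\begin{pmatrix}0&0&ie^{u/2}\\ -i\psi e^{-u}&0&0\\ 0&ie^{u/2}&0\end{pmatrix}+\mathrm{diag}\left(\tfrac{u_z}{2},-\tfrac{u_z}{2},0\right),\quad \mathbb{F}^{-1}\mathbb{F}_{\bar z}=\lambda\begin{pmatrix}0&-i\bar\psi e^{-u}&0\\ 0&0&ie^{u/2}\\ ie^{u/2}&0&0\end{pmatrix}+\mathrm{diag}\left(-\tfrac{u_{\bar z}}{2},\tfrac{u_{\bar z}}{2},0\right)$$ (equivalently, $\exp(zD(\lambda))=\mathbb{F}U_+$ is an Iwasawa decomposition). It satisfies $f(t+z,\lambda)=e^{tD(\lambda)}f(z,\lambda)$, $t\in\mathbb{R}$. *)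

theory Defs
  imports "HOL-Analysis.Analysis"
begin

typedef cp2 = "{range (\<lambda>c. c *s v) | v :: complex^3. v \<noteq> 0}"
  morphisms line_of Abs_cp2
proof -
  have "(axis 3 1 :: complex^3) \<noteq> 0"
    by (simp add: axis_eq_0_iff)
  then show ?thesis
    by blast
qed

text \<open>The class \<open>[v]\<close>; only meaningful for \<open>v \<noteq> 0\<close>.\<close>

definition cp2_class :: "complex^3 \<Rightarrow> cp2"
  where "cp2_class v = Abs_cp2 (range (\<lambda>c. c *s v))"

definition SU3 :: "(complex^3^3) set"
  where "SU3 = {A. transpose (map_matrix cnj A) ** A = mat 1 \<and> det A = 1}"

text \<open>The Wirtinger operators \<open>(\<partial>\<^sub>x \<mp> i \<partial>\<^sub>y)/2\<close>. The functions they are applied to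
  are real differentiable, not holomorphic.\<close>

definition wirtinger_z :: "(complex \<Rightarrow> complex) \<Rightarrow> complex \<Rightarrow> complex"
  where "wirtinger_z g z =
    (frechet_derivative g (at z) 1 - \<i> * frechet_derivative g (at z) \<i>) / 2"

definition wirtinger_zbar :: "(complex \<Rightarrow> complex) \<Rightarrow> complex \<Rightarrow> complex"
  where "wirtinger_zbar g z =
    (frechet_derivative g (at z) 1 + \<i> * frechet_derivative g (at z) \<i>) / 2"

definition matrix_wirtinger_z :: "(complex \<Rightarrow> complex^3^3) \<Rightarrow> complex \<Rightarrow> complex^3^3"
  where "matrix_wirtinger_z F z = (\<chi> i j. wirtinger_z (\<lambda>w. F w $ i $ j) z)"

definition matrix_wirtinger_zbar :: "(complex \<Rightarrow> complex^3^3) \<Rightarrow> complex \<Rightarrow> complex^3^3"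
  where "matrix_wirtinger_zbar F z = (\<chi> i j. wirtinger_zbar (\<lambda>w. F w $ i $ j) z)"

text \<open>A function \<open>u\<close> of \<open>y\<close> is regarded as the function \<open>z \<mapsto> u (Im z)\<close> on the plane.\<close>

definition frame_coeff_z :: "complex \<Rightarrow> (real \<Rightarrow> real) \<Rightarrow> complex \<Rightarrow> complex \<Rightarrow> complex^3^3"
  where "frame_coeff_z \<psi> u lam z =
    (let e = \<i> * of_real (exp (u (Im z) / 2));
         q = - \<i> * \<psi> * of_real (exp (- u (Im z)));
         uz = wirtinger_z (\<lambda>w. of_real (u (Im w))) z
     in map_matrix ((*) (lam powi (-1)))
          (vector [vector [0, 0, e],
                   vector [q, 0, 0],
                   vector [0, e, 0]])
        + vector [vector [uz / 2, 0, 0],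
                  vector [0, - uz / 2, 0],
                  vector [0, 0, 0]])"

definition frame_coeff_zbar :: "complex \<Rightarrow> (real \<Rightarrow> real) \<Rightarrow> complex \<Rightarrow> complex \<Rightarrow> complex^3^3"
  where "frame_coeff_zbar \<psi> u lam z =
    (let e = \<i> * of_real (exp (u (Im z) / 2));
         q = - \<i> * cnj \<psi> * of_real (exp (- u (Im z)));
         uzbar = wirtinger_zbar (\<lambda>w. of_real (u (Im w))) z
     in map_matrix ((*) lam)
          (vector [vector [0, q, 0],
                   vector [0, 0, e],
                   vector [e, 0, 0]])
        + vector [vector [- uzbar / 2, 0, 0],
                  vector [0, uzbar / 2, 0],
                  vector [0, 0, 0]])"

definition is_frame ::
    "complex \<Rightarrow> (real \<Rightarrow> real) \<Rightarrow> complex \<Rightarrow> (complex \<Rightarrow> complex^3^3) \<Rightarrow> bool"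
  where "is_frame \<psi> u lam F \<longleftrightarrow>
    F 0 = mat 1 \<and>
    (\<forall>z. F z \<in> SU3 \<and> F differentiable (at z) \<and>
      matrix_inv (F z) ** matrix_wirtinger_z F z = frame_coeff_z \<psi> u lam z \<and>
      matrix_inv (F z) ** matrix_wirtinger_zbar F z = frame_coeff_zbar \<psi> u lam z)"

definition surface_of_frame :: "(complex \<Rightarrow> complex^3^3) \<Rightarrow> complex \<Rightarrow> cp2"
  where "surface_of_frame F z = cp2_class (F z *v axis 3 1)"

definition coeff_a :: "(real \<Rightarrow> real) \<Rightarrow> complex"
  where "coeff_a u = \<i> * of_real (exp (u 0 / 2))"

definition coeff_b :: "complex \<Rightarrow> (real \<Rightarrow> real) \<Rightarrow> complex"
  where "coeff_b \<psi> u = \<i> * \<psi> / (coeff_a u)\<^sup>2"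

definition beta :: "complex \<Rightarrow> (real \<Rightarrow> real) \<Rightarrow> real"
  where "beta \<psi> u = 2 * (cmod (coeff_a u))\<^sup>2 + (cmod (coeff_b \<psi> u))\<^sup>2"

definition potential_D :: "complex \<Rightarrow> (real \<Rightarrow> real) \<Rightarrow> complex \<Rightarrow> complex^3^3"
  where "potential_D \<psi> u lam =
    (let a = coeff_a u; b = coeff_b \<psi> u
     in vector [vector [0, - lam * cnj b, lam powi (-1) * a],
                vector [lam powi (-1) * b, 0, - lam * cnj a],
                vector [- lam * cnj a, lam powi (-1) * a, 0]])"

text \<open>For \<open>\<bar>\<lambda>\<bar> = 1\<close> the common denominator of the integrands of \<open>\<beta>\<^sub>1\<close> and \<open>\<beta>\<^sub>2\<close> is
  \<open>- 2 i Im (\<lambda>\<^sup>-\<^sup>3 \<psi>) - e\<^sup>u u'\<close>. It has zeros only if \<open>Im (\<lambda>\<^sup>-\<^sup>3 \<psi>) = 0\<close>. In that case the real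
  part of the first integrand and the imaginary part of the second one vanish wherever the
  denominator does not, so \<open>Re \<beta>\<^sub>1 = Im \<beta>\<^sub>2 = 0\<close>: this is what integrating these parts gives,
  and it is also the value produced by the convention that the integral of a non-integrable
  function is \<open>0\<close>.\<close>

definition beta1 :: "complex \<Rightarrow> (real \<Rightarrow> real) \<Rightarrow> complex \<Rightarrow> real \<Rightarrow> complex"
  where "beta1 \<psi> u lam y =
    (LBINT s=0..ereal y.
      (2 * \<i> * lam ^ 3 * cnj \<psi> - \<i> * of_real (deriv u s) * of_real (exp (u s))) /
      (lam ^ 3 * cnj \<psi> - lam powi (-3) * \<psi> - of_real (exp (u s)) * of_real (deriv u s)))"

definition beta2 :: "complex \<Rightarrow> (real \<Rightarrow> real) \<Rightarrow> complex \<Rightarrow> real \<Rightarrow> complex"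
  where "beta2 \<psi> u lam y =
    (LBINT s=0..ereal y.
      2 * of_real (exp (u s)) /
      (lam ^ 3 * cnj \<psi> - lam powi (-3) * \<psi> - of_real (exp (u s)) * of_real (deriv u s)))"

definition equivariant_cylinder :: "complex set \<Rightarrow> (complex \<Rightarrow> 'a) \<Rightarrow> bool"
  where "equivariant_cylinder \<Omega> f \<longleftrightarrow> (\<exists>\<omega>\<in>\<Omega>. \<omega> \<noteq> 0 \<and> (\<forall>z. f (z + \<omega>) = f z))"

definition real_translations :: "complex set"
  where "real_translations = {of_real p | p. True}"

definition imaginary_translations :: "real \<Rightarrow> complex set"
  where "imaginary_translations T = {of_int m * (2 * of_real T * \<i>) | m. True}"

end

theory Submission
  imports Defs
begin

text \<open>Write \<open>S = \<lambda>\<^sub>0\<^sup>-\<^sup>3 \<psi>\<close>, \<open>E = e\<^sup>u\<close>, \<open>c = Re S\<close> and \<open>s = Im S\<close>. For a row vector \<open>w\<close> the product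
  \<open>w F\<close> of \<open>w\<close> with the frame satisfies a linear system, and after absorbing \<open>\<lambda>\<^sub>0\<close> into a constant
  diagonal gauge the coefficients of this system depend on \<open>u\<close> and \<open>S\<close> only: \<open>V\<^sub>x = X V\<close>,
  \<open>V\<^sub>y = Y V\<close>, with \<open>X\<close> and \<open>Y\<close> skew-Hermitian. The norm of a solution is therefore constant, which
  makes solutions unique, and the zero curvature condition (equivalent to the differential equation
  for \<open>u\<close>) says that \<open>X V\<close> is again a solution. Hence if \<open>w\<close> is a left eigenvector of \<open>D(\<lambda>\<^sub>0)\<close> for
  \<open>i d\<close>, then \<open>X V = i d V\<close> on the whole plane (\<open>eigen_persists\<close>).

  Three such solutions, one for each eigenvalue, give coordinates in which translations are diagonal.
  The translation by a real \<open>p\<close> multiplies \<open>V\<close> by \<open>e\<^bsup>idp\<^esup>\<close>. The translation by \<open>2Ti\<close> preserves the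
  system, because \<open>u\<close> has period \<open>2T\<close>, and multiplies \<open>V\<close> by a constant \<open>\<tau>\<close>, because the
  eigenspaces are lines. The third components of the three solutions are the homogeneous coordinates
  of the surface, and none of them vanishes at a height where \<open>u' \<noteq> 0\<close>. So a translation preserves the
  surface exactly if its three multipliers agree (\<open>surface_translation_iff\<close>).

  For real translations the closing condition is that some \<open>p \<noteq> 0\<close> makes all \<open>e\<^bsup>id\<^sub>jp\<^esup>\<close> equal, which
  together with \<open>d\<^sub>1 + d\<^sub>2 + d\<^sub>3 = 0\<close> means that \<open>d\<^sub>1/d\<^sub>2\<close> is rational. For imaginary ones it is that
  the \<open>\<tau>\<^sub>j\<^sup>m\<close> agree for some \<open>m \<noteq> 0\<close>; since \<open>\<tau>\<^sub>1 \<tau>\<^sub>2 \<tau>\<^sub>3 = det F(2Ti) = 1\<close>, this means that every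
  \<open>\<tau>\<^sub>j\<close> is a root of unity.

  It remains to compute \<open>\<tau>\<close> up to such roots. With \<open>\<kappa> = (\<beta> - d\<^sup>2)/2\<close>, where \<open>c = d \<kappa>\<close>, elimination
  in \<open>X V = i d V\<close> shows that the third component \<open>r\<close> of \<open>V\<close> satisfies
  \<open>(E - \<kappa>) r\<^sub>y = (E u'/2 + i s) r\<close>, so that
  \<open>r\<^sup>2 / (E - \<kappa>)\<close> has logarithmic derivative \<open>2 i s / (E - \<kappa>)\<close>. The first integral
  \<open>(E u'/2)\<^sup>2 + s\<^sup>2 = \<beta> E\<^sup>2 - 2 E\<^sup>3 - c\<^sup>2\<close> has the factor \<open>E - \<kappa>\<close>, and splitting \<open>s / (E - \<kappa>)\<close> over this
  common denominator produces the integrands of \<open>Re \<beta>\<^sub>1\<close> and \<open>Im \<beta>\<^sub>2\<close>, together with a third integral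
  that does not depend on \<open>d\<close>. Consequently \<open>\<tau>\<^sub>j\<^sup>2 = exp (2 i (C - \<Phi>\<^sub>j))\<close>, where \<open>\<Phi>\<^sub>j\<close> is the
  left-hand side in the claim and \<open>C\<close> is common to the three eigenvalues (\<open>monodromy_square\<close>). Since
  \<open>\<Phi>\<^sub>1 + \<Phi>\<^sub>2 + \<Phi>\<^sub>3 = 0\<close> and \<open>\<tau>\<^sub>1 \<tau>\<^sub>2 \<tau>\<^sub>3 = 1\<close>, the constant \<open>C\<close> is a rational multiple of \<open>2\<pi>\<close>, and
  \<open>\<tau>\<^sub>j\<close> is a root of unity exactly if \<open>\<Phi>\<^sub>j\<close> is a rational multiple of \<open>2\<pi>\<close>.

  If \<open>s = 0\<close>, then both integrals vanish. In this case the gauged \<open>Y\<close> is real, so the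
  bilinear form \<open>V \<cdot> V\<close> is constant in \<open>y\<close>; as it does not vanish, \<open>\<tau>\<^sup>2 = 1\<close>, which is the
  same formula with \<open>C = \<Phi> = 0\<close>.\<close>

section \<open>The Lax pair of the Tzitzeica equation\<close>

text \<open>The operators \<open>X\<close> and \<open>Y\<close> of the system for \<open>w F\<close>, after multiplying the components by
  \<open>\<lambda>\<^sup>-\<^sup>1\<close>, \<open>\<lambda>\<close> and \<open>1\<close>; the spectral parameter survives only in \<open>S = \<lambda>\<^sup>-\<^sup>3 \<psi>\<close>.\<close>

definition lax_x :: "(real \<Rightarrow> real) \<Rightarrow> complex \<Rightarrow> real \<Rightarrow> complex^3 \<Rightarrow> complex^3"
  where "lax_x u S y v = vector
    [- \<i> * of_real (deriv u y / 2) * v $ 1 - \<i> * S * of_real (exp (- u y)) * v $ 2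
       + \<i> * of_real (exp (u y / 2)) * v $ 3,
     - \<i> * cnj S * of_real (exp (- u y)) * v $ 1 + \<i> * of_real (deriv u y / 2) * v $ 2
       + \<i> * of_real (exp (u y / 2)) * v $ 3,
     \<i> * of_real (exp (u y / 2)) * (v $ 1 + v $ 2)]"

definition lax_y :: "(real \<Rightarrow> real) \<Rightarrow> complex \<Rightarrow> real \<Rightarrow> complex^3 \<Rightarrow> complex^3"
  where "lax_y u S y v = vector
    [S * of_real (exp (- u y)) * v $ 2 + of_real (exp (u y / 2)) * v $ 3,
     - cnj S * of_real (exp (- u y)) * v $ 1 - of_real (exp (u y / 2)) * v $ 3,
     of_real (exp (u y / 2)) * (v $ 2 - v $ 1)]"

definition parallel :: "(real \<Rightarrow> real) \<Rightarrow> complex \<Rightarrow> (complex \<Rightarrow> complex^3) \<Rightarrow> bool"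
  where "parallel u S V \<longleftrightarrow> (\<forall>z. (V has_derivative
    (\<lambda>h. Re h *\<^sub>R lax_x u S (Im z) (V z) + Im h *\<^sub>R lax_y u S (Im z) (V z))) (at z))"

lemma lax_x_linear: "lax_x u S y (v - c *s w) = lax_x u S y v - c *s lax_x u S y w"
  by (simp add: lax_x_def vec_eq_iff forall_3 algebra_simps diff_divide_distrib add_divide_distrib)

lemma lax_y_linear: "lax_y u S y (v - c *s w) = lax_y u S y v - c *s lax_y u S y w"
  by (simp add: lax_y_def vec_eq_iff forall_3 algebra_simps)

text \<open>The real inner product on \<open>\<complex>\<^sup>3\<close> is the real part of the Hermitian one. Skewness of the Lax
  operators is therefore a polynomial identity over \<open>\<complex>\<close>.\<close>

lemma inner_eq_0_of_skew:
  fixes v w :: "complex^3"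
  assumes "(\<Sum>i\<in>UNIV. cnj (v $ i) * w $ i) + cnj (\<Sum>i\<in>UNIV. cnj (v $ i) * w $ i) = 0"
  shows "v \<bullet> w = 0"
proof -
  have "v \<bullet> w = Re (\<Sum>i\<in>UNIV. cnj (v $ i) * w $ i)"
    by (simp add: inner_vec_def inner_complex_def)
  then show ?thesis
    using arg_cong[OF assms, of Re] by simp
qed

lemma lax_x_skew: "v \<bullet> lax_x u S y v = 0"
  by (rule inner_eq_0_of_skew)
     (simp add: lax_x_def sum_3 ring_distribs add_divide_distrib ac_simps)

lemma lax_y_skew: "v \<bullet> lax_y u S y v = 0"
  by (rule inner_eq_0_of_skew) (simp add: lax_y_def sum_3 algebra_simps)

lemma has_derivative_complex3_iff:
  fixes f :: "'a::real_normed_vector \<Rightarrow> complex^3"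
  shows "(f has_derivative f') F \<longleftrightarrow> (\<forall>i. ((\<lambda>x. f x $ i) has_derivative (\<lambda>h. f' h $ i)) F)"
proof
  assume "(f has_derivative f') F"
  then show "\<forall>i. ((\<lambda>x. f x $ i) has_derivative (\<lambda>h. f' h $ i)) F"
    by (auto intro: bounded_linear.has_derivative[OF bounded_linear_vec_nth])
next
  assume *: "\<forall>i. ((\<lambda>x. f x $ i) has_derivative (\<lambda>h. f' h $ i)) F"
  have ax: "bounded_linear (\<lambda>c::complex. axis i c :: complex^3)" for i
    unfolding linear_conv_bounded_linear[symmetric]
    by (rule linearI) (auto simp: vec_eq_iff axis_def)
  have decomp: "v = (\<Sum>i\<in>UNIV. axis i (v $ i))" for v :: "complex^3"
    by (simp add: vec_eq_iff axis_def)
  have "((\<lambda>x. \<Sum>i\<in>UNIV. axis i (f x $ i)) has_derivative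
      (\<lambda>h. \<Sum>i\<in>UNIV. axis i (f' h $ i))) F"
    using * by (intro has_derivative_sum bounded_linear.has_derivative[OF ax]) auto
  then show "(f has_derivative f') F"
    by (simp only: flip: decomp)
qed

text \<open>The derivative of \<open>V \<bullet> V\<close> is twice the inner product of \<open>V\<close> with its derivative, and this
  vanishes because both Lax operators are skew.\<close>

lemma parallel_norm_constant:
  assumes "parallel u S V"
  shows "norm (V z) = norm (V w)"
proof -
  have "((\<lambda>z. V z \<bullet> V z) has_derivative (\<lambda>h. 0)) (at z)" for z
  proof -
    have "((\<lambda>z. V z \<bullet> V z) has_derivative (\<lambda>h.
        V z \<bullet> (Re h *\<^sub>R lax_x u S (Im z) (V z) + Im h *\<^sub>R lax_y u S (Im z) (V z)) +
        (Re h *\<^sub>R lax_x u S (Im z) (V z) + Im h *\<^sub>R lax_y u S (Im z) (V z)) \<bullet> V z)) (at z)"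
      using assms unfolding parallel_def by (intro has_derivative_inner) auto
    then show ?thesis
      by (simp add: inner_add_left inner_add_right lax_x_skew lax_y_skew
          inner_commute[of "lax_x u S (Im z) (V z)"] inner_commute[of "lax_y u S (Im z) (V z)"])
  qed
  then have "\<exists>c. \<forall>z\<in>UNIV. V z \<bullet> V z = c"
    by (intro has_derivative_zero_constant) auto
  then show ?thesis
    by (metis UNIV_I norm_eq_sqrt_inner)
qed

lemma parallel_diff:
  assumes "parallel u S V" "parallel u S W"
  shows "parallel u S (\<lambda>z. V z - c *s W z)"
  unfolding parallel_def
proof
  fix z
  have lin: "bounded_linear (\<lambda>v. c *s v :: complex^3)"
    unfolding linear_conv_bounded_linear[symmetric]
    by (rule linearI) (auto simp: vec_eq_iff algebra_simps)
  have "((\<lambda>z. V z - c *s W z) has_derivative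
      (\<lambda>h. (Re h *\<^sub>R lax_x u S (Im z) (V z) + Im h *\<^sub>R lax_y u S (Im z) (V z))
        - c *s (Re h *\<^sub>R lax_x u S (Im z) (W z) + Im h *\<^sub>R lax_y u S (Im z) (W z)))) (at z)"
    by (intro has_derivative_diff bounded_linear.has_derivative[OF lin]
        assms[unfolded parallel_def, rule_format])
  moreover have "a *\<^sub>R v1 + b *\<^sub>R v2 - c *s (a *\<^sub>R w1 + b *\<^sub>R w2)
      = a *\<^sub>R (v1 - c *s w1) + b *\<^sub>R (v2 - c *s w2)" for a b and v1 v2 w1 w2 :: "complex^3"
    by (simp add: vec_eq_iff scaleR_right_diff_distrib ring_distribs)
  ultimately show "((\<lambda>z. V z - c *s W z) has_derivative
      (\<lambda>h. Re h *\<^sub>R lax_x u S (Im z) (V z - c *s W z)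
        + Im h *\<^sub>R lax_y u S (Im z) (V z - c *s W z))) (at z)"
    by (simp only: lax_x_linear lax_y_linear)
qed

text \<open>A solution that vanishes at one point has norm zero everywhere; apply this to \<open>V - c W\<close>.\<close>

lemma parallel_unique:
  assumes "parallel u S V" "parallel u S W" "V z0 = c *s W z0"
  shows "V z = c *s W z"
  using parallel_norm_constant[OF parallel_diff[OF assms(1,2), of c], of z z0] assms(3)
  by simp

lemma parallel_translate:
  assumes "parallel u S V"
    and "\<And>y. u (y + Im \<omega>) = u y" and "\<And>y. deriv u (y + Im \<omega>) = deriv u y"
  shows "parallel u S (\<lambda>z. V (z + \<omega>))"
  unfolding parallel_def
proof
  fix z
  have "((\<lambda>z. z + \<omega>) has_derivative (\<lambda>h. h)) (at z)"
    by (auto intro!: derivative_eq_intros)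
  moreover have "(V has_derivative (\<lambda>h. Re h *\<^sub>R lax_x u S (Im (z + \<omega>)) (V (z + \<omega>))
      + Im h *\<^sub>R lax_y u S (Im (z + \<omega>)) (V (z + \<omega>)))) (at (z + \<omega>))"
    using assms(1) unfolding parallel_def by blast
  ultimately have "((\<lambda>z. V (z + \<omega>)) has_derivative
     (\<lambda>h. Re h *\<^sub>R lax_x u S (Im (z + \<omega>)) (V (z + \<omega>))
      + Im h *\<^sub>R lax_y u S (Im (z + \<omega>)) (V (z + \<omega>)))) (at z)"
    by (rule has_derivative_compose)
  moreover have "lax_x u S (Im (z + \<omega>)) = lax_x u S (Im z)"
    "lax_y u S (Im (z + \<omega>)) = lax_y u S (Im z)"
    by (simp_all add: lax_x_def lax_y_def assms(2,3) fun_eq_iff)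
  ultimately show "((\<lambda>z. V (z + \<omega>)) has_derivative (\<lambda>h. Re h *\<^sub>R lax_x u S (Im z) (V (z + \<omega>))
      + Im h *\<^sub>R lax_y u S (Im z) (V (z + \<omega>)))) (at z)"
    by simp
qed

locale tzitzeica =
  fixes u :: "real \<Rightarrow> real" and S :: complex
  assumes u_deriv: "\<And>y. (u has_real_derivative deriv u y) (at y)"
    and u'_deriv: "\<And>y. (deriv u has_real_derivative
          4 * ((cmod S)\<^sup>2 * exp (- 2 * u y) - exp (u y))) (at y)"
begin

text \<open>The derivative in \<open>y\<close> of the coefficients of \<open>X\<close>, with \<open>u''\<close> replaced by means of the
  differential equation.\<close>

definition lax_x_dot :: "real \<Rightarrow> complex^3 \<Rightarrow> complex^3"
  where "lax_x_dot y v = vector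
    [- \<i> * of_real (2 * ((cmod S)\<^sup>2 * exp (- 2 * u y) - exp (u y))) * v $ 1
       + \<i> * S * of_real (deriv u y * exp (- u y)) * v $ 2
       + \<i> * of_real (deriv u y / 2 * exp (u y / 2)) * v $ 3,
     \<i> * cnj S * of_real (deriv u y * exp (- u y)) * v $ 1
       + \<i> * of_real (2 * ((cmod S)\<^sup>2 * exp (- 2 * u y) - exp (u y))) * v $ 2
       + \<i> * of_real (deriv u y / 2 * exp (u y / 2)) * v $ 3,
     \<i> * of_real (deriv u y / 2 * exp (u y / 2)) * (v $ 1 + v $ 2)]"

text \<open>This is \<open>X' = [Y, X]\<close>, the compatibility condition of the Lax pair. The equation for \<open>u\<close> enters
  through the diagonal of \<open>lax_x_dot\<close>; the off-diagonal entries agree for every \<open>u\<close>.\<close>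

lemma zero_curvature:
  "lax_x_dot y v + lax_x u S y (lax_y u S y v) = lax_y u S y (lax_x u S y v)"
proof -
  define g e h where "g = complex_of_real (exp (- u y))" and "e = complex_of_real (exp (u y / 2))"
    and "h = complex_of_real (deriv u y / 2)"
  have sq: "complex_of_real (exp (- 2 * u y)) = g * g" "complex_of_real (exp (u y)) = e * e"
    by (simp_all add: g_def e_def mult_exp_exp flip: of_real_mult)
  have norm_S: "complex_of_real ((cmod S)\<^sup>2) = S * cnj S"
    by (rule complex_norm_square)
  have coeffs: "complex_of_real (2 * ((cmod S)\<^sup>2 * exp (- 2 * u y) - exp (u y)))
      = 2 * (S * cnj S * (g * g) - e * e)"
    "complex_of_real (deriv u y * exp (- u y)) = 2 * h * g"
    "complex_of_real (deriv u y / 2 * exp (u y / 2)) = h * e"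
    unfolding of_real_mult of_real_diff norm_S sq of_real_numeral
    by (simp_all add: g_def e_def h_def)
  show ?thesis
    unfolding vec_eq_iff forall_3 lax_x_dot_def lax_x_def lax_y_def vector_3 coeffs
      vector_add_component g_def[symmetric] e_def[symmetric] h_def[symmetric]
    by (intro conjI; algebra)
qed

lemma has_derivative_lax_x:
  assumes "(V has_derivative V') (at z)"
  shows "((\<lambda>z. lax_x u S (Im z) (V z)) has_derivative
    (\<lambda>h. lax_x u S (Im z) (V' h) + Im h *\<^sub>R lax_x_dot (Im z) (V z))) (at z)"
proof -
  have V': "((\<lambda>z. V z $ i) has_derivative (\<lambda>h. V' h $ i)) (at z)" for i
    using assms by (simp add: has_derivative_complex3_iff)
  have scalar: "((\<lambda>z. complex_of_real (g (Im z))) has_derivative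
      (\<lambda>h. Im h *\<^sub>R complex_of_real g')) (at z)"
    if "(g has_real_derivative g') (at (Im z))" for g g'
  proof -
    have "(Im has_derivative Im) (at z)"
      using bounded_linear.has_derivative[OF bounded_linear_Im has_derivative_ident] .
    from has_derivative_compose[OF this that[unfolded has_field_derivative_def]]
    have "((\<lambda>z. g (Im z)) has_derivative (\<lambda>h. g' * Im h)) (at z)" .
    from has_derivative_of_real[OF this] show ?thesis
      by (simp add: scaleR_conv_of_real mult.commute)
  qed
  have summand: "((\<lambda>z. c * complex_of_real (g (Im z)) * V z $ i) has_derivative
      (\<lambda>h. c * complex_of_real (g (Im z)) * V' h $ i
        + Im h *\<^sub>R (c * complex_of_real g' * V z $ i))) (at z)"
    if "(g has_real_derivative g') (at (Im z))" for c g g' i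
    by (rule has_derivative_eq_rhs[OF has_derivative_mult[OF has_derivative_mult[OF
              has_derivative_const scalar[OF that]] V']]) (auto simp: algebra_simps)
  have d1: "((\<lambda>y. deriv u y / 2) has_real_derivative
      2 * ((cmod S)\<^sup>2 * exp (- 2 * u y) - exp (u y))) (at y)" for y
    by (auto intro!: derivative_eq_intros u'_deriv)
  have d2: "((\<lambda>y. exp (- u y)) has_real_derivative - (deriv u y * exp (- u y))) (at y)" for y
    by (auto intro!: derivative_eq_intros u_deriv)
  have d3: "((\<lambda>y. exp (u y / 2)) has_real_derivative deriv u y / 2 * exp (u y / 2)) (at y)" for y
    by (auto intro!: derivative_eq_intros u_deriv)
  have "((\<lambda>z. lax_x u S (Im z) (V z) $ 1) has_derivative
    (\<lambda>h. (lax_x u S (Im z) (V' h) + Im h *\<^sub>R lax_x_dot (Im z) (V z)) $ 1)) (at z)"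
    unfolding lax_x_def lax_x_dot_def vector_3 vector_add_component vector_scaleR_component
    by (rule has_derivative_eq_rhs[OF has_derivative_add[OF has_derivative_diff[OF
            summand[OF d1, of "- \<i>" 1] summand[OF d2, of "\<i> * S" 2]] summand[OF d3, of \<i> 3]]])
       (simp only: fun_eq_iff of_real_minus scaleR_add_right scaleR_diff_right, simp)
  moreover have "((\<lambda>z. lax_x u S (Im z) (V z) $ 2) has_derivative
    (\<lambda>h. (lax_x u S (Im z) (V' h) + Im h *\<^sub>R lax_x_dot (Im z) (V z)) $ 2)) (at z)"
    unfolding lax_x_def lax_x_dot_def vector_3 vector_add_component vector_scaleR_component
    by (rule has_derivative_eq_rhs[OF has_derivative_add[OF has_derivative_add[OF
            summand[OF d2, of "- \<i> * cnj S" 1] summand[OF d1, of "\<i>" 2]] summand[OF d3, of \<i> 3]]])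
       (simp only: fun_eq_iff of_real_minus scaleR_add_right scaleR_diff_right, simp)
  moreover have "((\<lambda>z. lax_x u S (Im z) (V z) $ 3) has_derivative
    (\<lambda>h. (lax_x u S (Im z) (V' h) + Im h *\<^sub>R lax_x_dot (Im z) (V z)) $ 3)) (at z)"
    unfolding lax_x_def lax_x_dot_def vector_3 vector_add_component vector_scaleR_component
      distrib_left
    by (rule has_derivative_eq_rhs[OF has_derivative_add[OF
            summand[OF d3, of \<i> 1] summand[OF d3, of \<i> 2]]])
       (simp only: fun_eq_iff scaleR_add_right, simp)
  ultimately show ?thesis
    unfolding has_derivative_complex3_iff forall_3 by blast
qed

text \<open>Differentiating \<open>X V\<close> in \<open>x\<close> gives \<open>X (X V)\<close>, since \<open>X\<close> does not depend on \<open>x\<close>;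
  differentiating it in \<open>y\<close> gives \<open>X' V + X Y V = Y (X V)\<close> by zero curvature.\<close>

lemma parallel_lax_x:
  assumes "parallel u S V"
  shows "parallel u S (\<lambda>z. lax_x u S (Im z) (V z))"
  unfolding parallel_def
proof
  fix z
  have *: "lax_x u S (Im z) (a *\<^sub>R lax_x u S (Im z) (V z) + b *\<^sub>R lax_y u S (Im z) (V z))
      + b *\<^sub>R lax_x_dot (Im z) (V z)
    = a *\<^sub>R lax_x u S (Im z) (lax_x u S (Im z) (V z))
      + b *\<^sub>R lax_y u S (Im z) (lax_x u S (Im z) (V z))" for a b
  proof -
    have "lax_x u S y (a *\<^sub>R v + b *\<^sub>R w) = a *\<^sub>R lax_x u S y v + b *\<^sub>R lax_x u S y w" for y v w
      unfolding lax_x_def vec_eq_iff forall_3 vector_3 vector_add_component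
        vector_scaleR_component
      unfolding scaleR_conv_of_real
      by (intro conjI; algebra)
    then show ?thesis
      unfolding zero_curvature[symmetric] by (simp add: algebra_simps)
  qed
  show "((\<lambda>z. lax_x u S (Im z) (V z)) has_derivative
      (\<lambda>h. Re h *\<^sub>R lax_x u S (Im z) (lax_x u S (Im z) (V z))
        + Im h *\<^sub>R lax_y u S (Im z) (lax_x u S (Im z) (V z)))) (at z)"
    using assms unfolding parallel_def
    by (intro has_derivative_eq_rhs[OF has_derivative_lax_x]) (auto simp: *)
qed

text \<open>Both \<open>X V\<close> and \<open>V\<close> are solutions, so a linear relation between them at one point holds
  everywhere.\<close>

lemma eigen_persists:
  assumes "parallel u S V" "lax_x u S (Im z0) (V z0) = c *s V z0"
  shows "lax_x u S (Im z) (V z) = c *s V z"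
  using parallel_unique[OF parallel_lax_x[OF assms(1)] assms] .

end

section \<open>The first integral and the eigenvectors of the Lax operator\<close>

text \<open>Elimination in the eigenvector equations at a fixed height, with \<open>h = u'/2\<close>,
  \<open>E = e\<^sup>u\<close> and \<open>P\<close>, \<open>Q\<close> the first two components multiplied by \<open>e\<^bsup>u/2\<^esup>\<close>. The sum of the first two
  equations determines \<open>Q - P\<close> as a multiple of \<open>r\<close>. Its coefficient contains the factor
  \<open>q = d\<^sup>2 E + c d - 2 E\<^sup>2\<close>, and \<open>(h E)\<^sup>2 + s\<^sup>2 = (E - \<kappa>) q\<close> converts it into the quotient
  \<open>(h E + i s) / (E - \<kappa>)\<close>. The use of \<open>\<kappa>\<close> instead of \<open>c / d\<close> includes the eigenvalue \<open>d = 0\<close>.\<close>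

lemma eigen_elimination:
  fixes P Q r :: complex and d h E c s \<kappa> :: real
  assumes eq1: "of_real ((d + h) * E) * P + (of_real c + \<i> * of_real s) * Q = of_real (E\<^sup>2) * r"
    and eq2: "of_real ((d - h) * E) * Q + (of_real c - \<i> * of_real s) * P = of_real (E\<^sup>2) * r"
    and eq3: "P + Q = of_real d * r"
    and c: "c = d * \<kappa>"
    and N: "(h * E)\<^sup>2 + s\<^sup>2 = (d\<^sup>2 + 2 * \<kappa>) * E\<^sup>2 - 2 * E ^ 3 - c\<^sup>2"
    and N_nonzero: "(h * E)\<^sup>2 + s\<^sup>2 \<noteq> 0"
  shows "of_real (E - \<kappa>) * (Q - P) = (of_real (h * E) + \<i> * of_real s) * r"
    and "E \<noteq> \<kappa>"
    and "r = 0 \<Longrightarrow> P = 0 \<and> Q = 0"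
proof -
  \<comment> \<open>The cofactor of \<open>E - \<kappa>\<close> in the first integral; it occurs again when \<open>Q - P\<close> is computed.\<close>
  define q where "q = d\<^sup>2 * E + c * d - 2 * E\<^sup>2"
  have fact: "(h * E)\<^sup>2 + s\<^sup>2 = (E - \<kappa>) * q"
    unfolding N q_def c by (simp add: power2_eq_square power3_eq_cube algebra_simps)
  then have q: "q \<noteq> 0" and E: "E \<noteq> \<kappa>"
    using N_nonzero by auto
  have "(Q - P) * (of_real (h * E) - \<i> * of_real s) = of_real q * r"
  proof -
    have "(Q - P) * (of_real (h * E) - \<i> * of_real s)
      = of_real (d * E + c) * (P + Q) - 2 * (of_real (E\<^sup>2) * r)"
      unfolding mult_2 by (subst eq1[symmetric], subst eq2[symmetric]) (simp add: algebra_simps)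
    then show ?thesis
      unfolding eq3 q_def by (simp add: power2_eq_square algebra_simps)
  qed
  then have "(Q - P) * (of_real (h * E) - \<i> * of_real s) * (of_real (h * E) + \<i> * of_real s)
      = of_real q * r * (of_real (h * E) + \<i> * of_real s)"
    by simp
  moreover have "(of_real (h * E) - \<i> * of_real s) * (of_real (h * E) + \<i> * of_real s)
      = complex_of_real ((E - \<kappa>) * q)"
    unfolding fact[symmetric] by (simp add: power2_eq_square algebra_simps)
  ultimately have "of_real q * (of_real (E - \<kappa>) * (Q - P))
      = of_real q * ((of_real (h * E) + \<i> * of_real s) * r)"
    unfolding of_real_mult by algebra
  then show main: "of_real (E - \<kappa>) * (Q - P) = (of_real (h * E) + \<i> * of_real s) * r"
    using q by simp
  show "E \<noteq> \<kappa>"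
    by (rule E)
  show "P = 0 \<and> Q = 0" if "r = 0"
  proof -
    have "Q = P"
      using main E that by simp
    then show ?thesis
      using eq3 that by simp
  qed
qed

context tzitzeica
begin

text \<open>For \<open>u'(0) = 0\<close> this is the constant \<open>\<beta>\<close>.\<close>

definition energy :: real
  where "energy = (deriv u 0)\<^sup>2 / 4 + 2 * exp (u 0) + (cmod S)\<^sup>2 * exp (- 2 * u 0)"

lemma first_integral:
  "(deriv u y)\<^sup>2 / 4 + 2 * exp (u y) + (cmod S)\<^sup>2 * exp (- 2 * u y) = energy"
proof -
  have "((\<lambda>y. (deriv u y)\<^sup>2 / 4 + 2 * exp (u y) + (cmod S)\<^sup>2 * exp (- 2 * u y))
      has_real_derivative 0) (at y)" for y
    by (rule derivative_eq_intros u_deriv u'_deriv refl | simp)+ (simp add: field_simps)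
  then show ?thesis
    unfolding energy_def by (rule DERIV_isconst_all[rule_format])
qed

text \<open>The first integral multiplied by \<open>e\<^bsup>2u\<^esup>\<close>, with \<open>|S|\<^sup>2\<close> split into the squares of the real and
  the imaginary part. The left-hand side is a quarter of the squared absolute value of the
  denominator in the integrands of \<open>\<beta>\<^sub>1\<close> and \<open>\<beta>\<^sub>2\<close>.\<close>

lemma energy_quadratic:
  "(deriv u y / 2 * exp (u y))\<^sup>2 + (Im S)\<^sup>2
    = energy * (exp (u y))\<^sup>2 - 2 * exp (u y) ^ 3 - (Re S)\<^sup>2"
proof -
  have "exp (- 2 * u y) * (exp (u y))\<^sup>2 = 1"
    by (simp add: exp_double[symmetric] mult_exp_exp)
  then have "energy * (exp (u y))\<^sup>2 = (deriv u y / 2 * exp (u y))\<^sup>2 + 2 * exp (u y) ^ 3 + (cmod S)\<^sup>2"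
    unfolding first_integral[of y, symmetric]
    by (simp add: distrib_right power_mult_distrib power_divide mult.assoc power2_eq_square power3_eq_cube)
  then show ?thesis
    by (simp add: cmod_power2)
qed

text \<open>The consequences of the elimination for an eigenvector of \<open>X\<close>. The cubic is the characteristic
  equation, which gives \<open>Re S = d \<kappa>\<close>. Away from the degenerate case \<open>u' = 0\<close>, \<open>Im S = 0\<close> an eigenvector
  is determined by its third component, so that the eigenspaces are lines.\<close>

lemma eigenvector_algebra:
  assumes ev: "lax_x u S y v = (\<i> * of_real d) *s v"
    and cubic: "d ^ 3 - energy * d + 2 * Re S = 0"
    and nondeg: "deriv u y \<noteq> 0 \<or> Im S \<noteq> 0"
  defines "\<kappa> \<equiv> (energy - d\<^sup>2) / 2"
  shows "of_real (exp (u y) - \<kappa>) * lax_y u S y v $ 3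
      = (of_real (deriv u y / 2 * exp (u y)) + \<i> * of_real (Im S)) * v $ 3"
    and "exp (u y) \<noteq> \<kappa>"
    and "v $ 3 = 0 \<Longrightarrow> v = 0"
    and "of_real (exp (u y / 2)) * (v $ 1 + v $ 2) = of_real d * v $ 3"
proof -
  define h E e g where "h = deriv u y / 2" and "E = exp (u y)" and "e = exp (u y / 2)"
    and "g = exp (- u y)"
  have rel: "E = e * e" "e * e * g = 1" "e \<noteq> 0"
    by (simp_all add: E_def e_def g_def mult_exp_exp)
  have c1: "- of_real h * v $ 1 - S * of_real g * v $ 2 + of_real e * v $ 3 = of_real d * v $ 1"
    and c2: "- cnj S * of_real g * v $ 1 + of_real h * v $ 2 + of_real e * v $ 3 = of_real d * v $ 2"
    and c3: "of_real e * (v $ 1 + v $ 2) = of_real d * v $ 3"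
  proof -
    have *: "\<i> * a = \<i> * b \<Longrightarrow> a = b" for a b by simp
    note ev' = ev[unfolded lax_x_def vec_eq_iff forall_3 vector_3 vector_smult_component
        h_def[symmetric] e_def[symmetric] g_def[symmetric]]
    show "- of_real h * v $ 1 - S * of_real g * v $ 2 + of_real e * v $ 3 = of_real d * v $ 1"
      by (rule *) (use ev'[THEN conjunct1] in \<open>simp add: algebra_simps\<close>)
    show "- cnj S * of_real g * v $ 1 + of_real h * v $ 2 + of_real e * v $ 3 = of_real d * v $ 2"
      by (rule *) (use ev'[THEN conjunct2, THEN conjunct1] in \<open>simp add: algebra_simps\<close>)
    show "of_real e * (v $ 1 + v $ 2) = of_real d * v $ 3"
      by (rule *) (use ev'[THEN conjunct2, THEN conjunct2] in \<open>simp add: algebra_simps\<close>)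
  qed
  have S: "of_real (Re S) + \<i> * of_real (Im S) = S" "of_real (Re S) - \<i> * of_real (Im S) = cnj S"
    by (simp_all add: complex_eq_iff)
  have cE: "complex_of_real E = of_real e * of_real e" "complex_of_real E * of_real g = 1"
    using rel by (simp_all flip: of_real_mult)
  define P Q where "P = of_real e * v $ 1" and "Q = of_real e * v $ 2"
  have eq1: "of_real ((d + h) * E) * P + (of_real (Re S) + \<i> * of_real (Im S)) * Q = of_real (E\<^sup>2) * v $ 3"
    unfolding S P_def of_real_mult of_real_add of_real_power using c1 cE unfolding Q_def by algebra
  have eq2: "of_real ((d - h) * E) * Q + (of_real (Re S) - \<i> * of_real (Im S)) * P = of_real (E\<^sup>2) * v $ 3"
    unfolding S Q_def of_real_mult of_real_diff of_real_power using c2 cE unfolding P_def by algebra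
  have PQ: "P + Q = of_real d * v $ 3"
    using c3 by (simp add: P_def Q_def algebra_simps)
  have c: "Re S = d * \<kappa>"
    using cubic by (simp add: \<kappa>_def field_simps power2_eq_square power3_eq_cube)
  have N: "(h * E)\<^sup>2 + (Im S)\<^sup>2 = (d\<^sup>2 + 2 * \<kappa>) * E\<^sup>2 - 2 * E ^ 3 - (Re S)\<^sup>2"
  proof -
    have "d\<^sup>2 + 2 * \<kappa> = energy"
      unfolding \<kappa>_def by (simp add: field_simps)
    then show ?thesis
      using energy_quadratic[of y] by (simp only: h_def E_def)
  qed
  have N0: "(h * E)\<^sup>2 + (Im S)\<^sup>2 \<noteq> 0"
    using nondeg by (simp add: h_def E_def sum_power2_eq_zero_iff)
  note res = eigen_elimination[OF eq1 eq2 PQ c N N0]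
  have "lax_y u S y v $ 3 = Q - P"
    by (simp add: lax_y_def P_def Q_def e_def algebra_simps)
  with res(1) show "of_real (exp (u y) - \<kappa>) * lax_y u S y v $ 3
      = (of_real (deriv u y / 2 * exp (u y)) + \<i> * of_real (Im S)) * v $ 3"
    by (simp add: E_def h_def)
  show "exp (u y) \<noteq> \<kappa>"
    using res(2) by (simp add: E_def)
  show "v = 0" if "v $ 3 = 0"
    using res(3)[OF that] that rel(3) by (simp add: P_def Q_def vec_eq_iff forall_3)
  show "of_real (exp (u y / 2)) * (v $ 1 + v $ 2) = of_real d * v $ 3"
    using c3 by (simp add: e_def)
qed

end

section \<open>Eigensolutions and their multipliers under translations\<close>

lemma parallel_along_x:
  assumes "parallel u S V"
  shows "((\<lambda>t. V (z + of_real t)) has_vector_derivative lax_x u S (Im z) (V (z + of_real t))) (at t)"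
proof -
  have "((\<lambda>t. z + complex_of_real t) has_derivative of_real) (at t)"
    by (auto intro!: derivative_eq_intros)
  moreover have "(V has_derivative (\<lambda>h. Re h *\<^sub>R lax_x u S (Im z) (V (z + of_real t))
      + Im h *\<^sub>R lax_y u S (Im z) (V (z + of_real t)))) (at (z + of_real t))"
    using assms[unfolded parallel_def, rule_format, of "z + of_real t"] by simp
  ultimately have "((\<lambda>t. V (z + of_real t)) has_derivative
      (\<lambda>h. Re (of_real h) *\<^sub>R lax_x u S (Im z) (V (z + of_real t))
        + Im (of_real h) *\<^sub>R lax_y u S (Im z) (V (z + of_real t)))) (at t)"
    by (rule has_derivative_compose)
  then show ?thesis
    by (simp add: has_vector_derivative_def)
qed

lemma parallel_along_y:
  assumes "parallel u S V"
  shows "((\<lambda>t. V (\<i> * of_real t)) has_vector_derivative lax_y u S t (V (\<i> * of_real t))) (at t)"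
proof -
  have "((\<lambda>t. \<i> * complex_of_real t) has_derivative (\<lambda>h. \<i> * of_real h)) (at t)"
    by (auto intro!: derivative_eq_intros)
  moreover have "(V has_derivative (\<lambda>h. Re h *\<^sub>R lax_x u S t (V (\<i> * of_real t))
      + Im h *\<^sub>R lax_y u S t (V (\<i> * of_real t)))) (at (\<i> * of_real t))"
    using assms[unfolded parallel_def, rule_format, of "\<i> * of_real t"] by simp
  ultimately have "((\<lambda>t. V (\<i> * of_real t)) has_derivative
      (\<lambda>h. Re (\<i> * of_real h) *\<^sub>R lax_x u S t (V (\<i> * of_real t))
        + Im (\<i> * of_real h) *\<^sub>R lax_y u S t (V (\<i> * of_real t)))) (at t)"
    by (rule has_derivative_compose)
  then show ?thesis
    by (simp add: has_vector_derivative_def)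
qed

lemma has_vector_derivative_phase:
  assumes "(g has_real_derivative g') (at t within A)"
  shows "((\<lambda>t. exp (\<i> * of_real (g t))) has_vector_derivative
    \<i> * of_real g' * exp (\<i> * of_real (g t))) (at t within A)"
proof -
  have "((\<lambda>t. complex_of_real (g t)) has_vector_derivative of_real g') (at t within A)"
    using assms by (intro has_vector_derivative_of_real)
      (simp add: has_real_derivative_iff_has_vector_derivative)
  then have "((\<lambda>t. \<i> * complex_of_real (g t)) has_vector_derivative \<i> * of_real g') (at t within A)"
    by (rule has_vector_derivative_mult_right)
  from field_vector_diff_chain_within[OF this, of exp "exp (\<i> * of_real (g t))"]
  show ?thesis
    by (simp add: o_def DERIV_subset[OF DERIV_exp])
qed

context tzitzeica
begin

definition eigensolution :: "real \<Rightarrow> (complex \<Rightarrow> complex^3) \<Rightarrow> bool"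
  where "eigensolution d V \<longleftrightarrow> parallel u S V \<and> V 0 \<noteq> 0 \<and>
    (\<forall>z. lax_x u S (Im z) (V z) = (\<i> * of_real d) *s V z) \<and>
    d ^ 3 - energy * d + 2 * Re S = 0"

lemma eigensolution_nonzero: "eigensolution d V \<Longrightarrow> V z \<noteq> 0"
  using parallel_norm_constant[of u S V z 0] by (auto simp: eigensolution_def)

lemma eigensolution_third_nonzero:
  assumes "eigensolution d V" "deriv u (Im z) \<noteq> 0 \<or> Im S \<noteq> 0"
  shows "V z $ 3 \<noteq> 0"
  using eigenvector_algebra(3)[of "Im z" "V z" d] assms eigensolution_nonzero[OF assms(1), of z]
  by (auto simp: eigensolution_def)

text \<open>Along a horizontal line \<open>V\<^sub>x = X V = i d V\<close>.\<close>

lemma eigensolution_translate_real: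
  assumes "eigensolution d V"
  shows "V (z + of_real p) = exp (\<i> * of_real (d * p)) *s V z"
proof -
  have "V (z + of_real p) $ i = exp (\<i> * of_real (d * p)) * V z $ i" for i
  proof -
    have const: "((\<lambda>t. exp (\<i> * of_real (- d * t)) * V (z + of_real t) $ i) has_vector_derivative 0)
        (at t within UNIV)" for t
    proof -
      have "((\<lambda>t. V (z + of_real t) $ i) has_vector_derivative
          \<i> * of_real d * V (z + of_real t) $ i) (at t)"
      proof -
        have "parallel u S V"
          and "lax_x u S (Im (z + of_real t)) (V (z + of_real t)) = (\<i> * of_real d) *s V (z + of_real t)"
          using assms unfolding eigensolution_def by blast+
        then show ?thesis
          using bounded_linear.has_vector_derivative[OF bounded_linear_vec_nth
              parallel_along_x[of u S V z t], of i] by simp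
      qed
      moreover have "((\<lambda>t. exp (\<i> * of_real (- d * t))) has_vector_derivative
          \<i> * of_real (- d) * exp (\<i> * of_real (- d * t))) (at t)"
        by (rule has_vector_derivative_phase) (auto intro!: derivative_eq_intros)
      ultimately show ?thesis
        using has_vector_derivative_mult by fastforce
    qed
    obtain c where "\<And>t. t \<in> UNIV \<Longrightarrow> exp (\<i> * of_real (- d * t)) * V (z + of_real t) $ i = c"
      using has_vector_derivative_zero_constant[OF convex_UNIV const] by blast
    from this[of p] this[of 0]
    have "exp (\<i> * of_real (- d * p)) * V (z + of_real p) $ i = V z $ i"
      by simp
    then show ?thesis
      by (simp add: exp_minus field_simps)
  qed
  then show ?thesis
    by (simp add: vec_eq_iff)
qed

end

locale periodic_tzitzeica = tzitzeica +
  fixes T :: real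
  assumes T_pos: "T > 0"
    and period: "\<And>y. u (y + 2 * T) = u y"
    and nonconst: "\<exists>y. deriv u y \<noteq> 0"
begin

lemma deriv_period: "deriv u (y + 2 * T) = deriv u y"
proof -
  have "((\<lambda>y. u (y + 2 * T)) has_real_derivative deriv u (y + 2 * T)) (at y)"
    using u_deriv[of "y + 2 * T"] by (simp add: DERIV_shift)
  then show ?thesis
    unfolding period by (rule DERIV_imp_deriv[symmetric])
qed

text \<open>The translated solution is again an eigensolution, since \<open>u\<close> is periodic. At a height where
  \<open>u' \<noteq> 0\<close> the eigenspace is a line, so it is a multiple of \<open>V\<close> there, and then everywhere by
  uniqueness.\<close>

lemma eigensolution_monodromy:
  assumes "eigensolution d V"
  obtains \<tau> where "\<And>z. V (z + 2 * of_real T * \<i>) = \<tau> *s V z"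
proof -
  obtain y where y: "deriv u y \<noteq> 0"
    using nonconst by blast
  define z0 where "z0 = \<i> * complex_of_real y"
  have [simp]: "Im z0 = y"
    by (simp add: z0_def)
  have V: "parallel u S V" and W: "parallel u S (\<lambda>z. V (z + 2 * of_real T * \<i>))"
    using assms parallel_translate[of u S V "2 * of_real T * \<i>"]
    by (auto simp: eigensolution_def period deriv_period)
  have V3: "V z0 $ 3 \<noteq> 0"
    using eigensolution_third_nonzero[OF assms, of z0] y by simp
  define \<tau> where "\<tau> = V (z0 + 2 * of_real T * \<i>) $ 3 / V z0 $ 3"
  define v where "v = V (z0 + 2 * of_real T * \<i>) - \<tau> *s V z0"
  have ev: "lax_x u S (Im z) (V z) = (\<i> * of_real d) *s V z" for z
    using assms by (simp add: eigensolution_def)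
  have "lax_x u S (y + 2 * T) = lax_x u S y"
    by (simp add: lax_x_def fun_eq_iff period deriv_period)
  with ev[of z0] ev[of "z0 + 2 * of_real T * \<i>"]
  have "lax_x u S y v = (\<i> * of_real d) *s V (z0 + 2 * of_real T * \<i>)
      - \<tau> *s ((\<i> * of_real d) *s V z0)"
    by (simp add: v_def lax_x_linear)
  then have "lax_x u S y v = (\<i> * of_real d) *s v"
    by (simp add: v_def vec_eq_iff algebra_simps)
  moreover have "v $ 3 = 0"
    using V3 by (simp add: v_def \<tau>_def)
  ultimately have "v = 0"
    using eigenvector_algebra(3)[of y v d] y assms by (simp add: eigensolution_def)
  then have "V (z0 + 2 * of_real T * \<i>) = \<tau> *s V z0"
    by (simp add: v_def)
  then show thesis
    using parallel_unique[OF W V] that by blast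
qed

text \<open>For real \<open>S\<close> the operator \<open>Y\<close> is not only skew-Hermitian but also skew for the complex bilinear
  form \<open>V \<cdot> V\<close>, which is therefore constant along vertical lines, while the translation by \<open>2Ti\<close>
  multiplies it by \<open>\<tau>\<^sup>2\<close>. It is nonzero because, where \<open>u' \<noteq> 0\<close>, the components of an
  eigenvector are real multiples of the third one.\<close>

lemma monodromy_square_degenerate:
  assumes V: "eigensolution d V"
    and \<tau>: "\<And>z. V (z + 2 * of_real T * \<i>) = \<tau> *s V z"
    and S: "Im S = 0"
  shows "\<tau>\<^sup>2 = 1"
proof -
  define B where "B t = (\<Sum>i\<in>UNIV. V (\<i> * of_real t) $ i * V (\<i> * of_real t) $ i)" for t
  have par: "parallel u S V"
    using V by (simp add: eigensolution_def)
  have cnj_S: "cnj S = S"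
    using S by (simp add: complex_eq_iff)
  have const: "(B has_vector_derivative 0) (at t within UNIV)" for t
  proof -
    have "((\<lambda>t. V (\<i> * of_real t) $ i) has_vector_derivative
        lax_y u S t (V (\<i> * of_real t)) $ i) (at t)" for i
      by (rule bounded_linear.has_vector_derivative[OF bounded_linear_vec_nth
            parallel_along_y[OF par]])
    then have "(B has_vector_derivative (\<Sum>i\<in>UNIV. V (\<i> * of_real t) $ i * lax_y u S t (V (\<i> * of_real t)) $ i
        + lax_y u S t (V (\<i> * of_real t)) $ i * V (\<i> * of_real t) $ i)) (at t)"
      unfolding B_def by (intro has_vector_derivative_sum has_vector_derivative_mult)
    moreover have "(\<Sum>i\<in>UNIV. v $ i * lax_y u S t v $ i + lax_y u S t v $ i * v $ i) = 0" for v
      by (simp add: sum_3 lax_y_def cnj_S algebra_simps)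
    ultimately show ?thesis
      by simp
  qed
  obtain y where y: "deriv u y \<noteq> 0"
    using nonconst by blast
  have "B (y + 2 * T) = B y"
    using has_vector_derivative_zero_constant[OF convex_UNIV const] by (metis UNIV_I)
  moreover have "B (y + 2 * T) = \<tau>\<^sup>2 * B y"
    using \<tau>[of "\<i> * of_real y"]
    by (simp add: B_def sum_3 algebra_simps power2_eq_square)
  moreover have "B y \<noteq> 0"
  proof -
    define v where "v = V (\<i> * of_real y)"
    define \<kappa> where "\<kappa> = (energy - d\<^sup>2) / 2"
    \<comment> \<open>The real number with \<open>e\<^bsup>u/2\<^esup> (v\<^sub>2 - v\<^sub>1) = t v\<^sub>3\<close>.\<close>
    define t where "t = deriv u y / 2 * exp (u y) / (exp (u y) - \<kappa>)"
    have "lax_x u S (Im (\<i> * of_real y)) v = (\<i> * of_real d) *s v"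
      using V unfolding eigensolution_def v_def by blast
    then have "lax_x u S y v = (\<i> * of_real d) *s v" "d ^ 3 - energy * d + 2 * Re S = 0"
      using V by (simp_all add: eigensolution_def)
    note eig = eigenvector_algebra[OF this disjI1[OF y]]
    have v3: "v $ 3 \<noteq> 0"
      using eig(3) eigensolution_nonzero[OF V, of "\<i> * of_real y"] by (auto simp: v_def)
    define e where "e = exp (u y / 2)"
    have "of_real e * (v $ 2 - v $ 1) = of_real t * v $ 3"
    proof -
      define D where "D = exp (u y) - \<kappa>"
      have "D \<noteq> 0" and "of_real D * lax_y u S y v $ 3 = of_real (deriv u y / 2 * exp (u y)) * v $ 3"
        using eig(1,2) S by (simp_all only: D_def \<kappa>_def) simp_all
      then have "lax_y u S y v $ 3 = of_real t * v $ 3"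
        unfolding t_def D_def[symmetric] of_real_divide by (simp add: eq_divide_eq ac_simps)
      then show ?thesis
        by (simp add: lax_y_def e_def)
    qed
    moreover have "of_real e * (v $ 1 + v $ 2) = of_real d * v $ 3"
      using eig(4) by (simp add: e_def)
    ultimately have "2 * (of_real e)\<^sup>2 * B y = (v $ 3)\<^sup>2 * of_real (d\<^sup>2 + t\<^sup>2 + 2 * e\<^sup>2)"
      unfolding B_def v_def[symmetric] sum_3 of_real_add of_real_mult of_real_power of_real_numeral
      by algebra
    moreover have "complex_of_real (d\<^sup>2 + t\<^sup>2 + 2 * e\<^sup>2) \<noteq> 0"
    proof -
      have "d\<^sup>2 + t\<^sup>2 + 2 * e\<^sup>2 > 0"
        by (intro add_nonneg_pos) (simp_all add: e_def)
      then show ?thesis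
        by (simp only: of_real_eq_0_iff)
    qed
    ultimately show ?thesis
      using v3 by (metis mult_eq_0_iff power_not_zero)
  qed
  ultimately show ?thesis
    by simp
qed

end

section \<open>The multiplier over one period as an exponential of integrals\<close>

context periodic_tzitzeica
begin

text \<open>The integrals \<open>\<beta>\<^sub>1\<close> and \<open>\<beta>\<^sub>2\<close>; for \<open>|\<lambda>| = 1\<close> they depend on \<open>\<lambda>\<close> and \<open>\<psi>\<close> only through
  \<open>S = \<lambda>\<^sup>-\<^sup>3 \<psi>\<close>.\<close>

definition integral1 :: "real \<Rightarrow> complex"
  where "integral1 y = (LBINT s=0..ereal y.
    (2 * \<i> * cnj S - \<i> * of_real (deriv u s) * of_real (exp (u s)))
      / (cnj S - S - of_real (exp (u s)) * of_real (deriv u s)))"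

definition integral2 :: "real \<Rightarrow> complex"
  where "integral2 y = (LBINT s=0..ereal y.
    2 * of_real (exp (u s)) / (cnj S - S - of_real (exp (u s)) * of_real (deriv u s)))"

text \<open>A quarter of the squared absolute value of the common denominator of the integrands.\<close>

definition radicand :: "real \<Rightarrow> real"
  where "radicand y = (deriv u y / 2 * exp (u y))\<^sup>2 + (Im S)\<^sup>2"

text \<open>Half the phase of \<open>\<tau>\<^sup>2\<close> is a quadratic polynomial in \<open>d\<close>; this is its constant coefficient.\<close>

definition integral3 :: "real \<Rightarrow> real"
  where "integral3 y = (LBINT s=0..ereal y. - 2 * Im S * (exp (u s))\<^sup>2 / radicand s)"

lemma continuous_u: "continuous_on A u" "continuous_on A (deriv u)"
  using u_deriv u'_deriv by (meson DERIV_continuous continuous_at_imp_continuous_on)+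

lemma integrand_parts:
  assumes "Im S \<noteq> 0"
  shows "Re ((2 * \<i> * cnj S - \<i> * of_real (deriv u y) * of_real (exp (u y)))
      / (cnj S - S - of_real (exp (u y)) * of_real (deriv u y))) = - Im S * Re S / radicand y"
    and "Im (2 * of_real (exp (u y)) / (cnj S - S - of_real (exp (u y)) * of_real (deriv u y)))
      = Im S * exp (u y) / radicand y"
proof -
  define w where "w = exp (u y) * deriv u y"
  have rad: "w\<^sup>2 + (2 * Im S)\<^sup>2 = 4 * radicand y"
    by (simp add: w_def radicand_def field_simps power2_eq_square)
  have den: "cnj S - S - of_real (exp (u y)) * of_real (deriv u y) = Complex (- w) (- 2 * Im S)"
    by (simp add: complex_eq_iff w_def)
  have num: "2 * \<i> * cnj S - \<i> * of_real (deriv u y) * of_real (exp (u y))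
      = Complex (2 * Im S) (2 * Re S - w)"
    by (simp add: complex_eq_iff w_def)
  show "Re ((2 * \<i> * cnj S - \<i> * of_real (deriv u y) * of_real (exp (u y)))
      / (cnj S - S - of_real (exp (u y)) * of_real (deriv u y))) = - Im S * Re S / radicand y"
    unfolding den num Re_divide complex.sel power2_minus mult_minus_left rad
    by (simp add: field_simps)
  show "Im (2 * of_real (exp (u y)) / (cnj S - S - of_real (exp (u y)) * of_real (deriv u y)))
      = Im S * exp (u y) / radicand y"
    unfolding den Im_divide complex.sel power2_minus mult_minus_left rad
    by (simp add: field_simps)
qed

lemma integral_derivatives:
  assumes S: "Im S \<noteq> 0" and t: "t \<in> {0..2 * T}"
  shows "((\<lambda>y. Re (integral1 y)) has_real_derivative - Im S * Re S / radicand t) (at t within {0..2 * T})"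
    and "((\<lambda>y. Im (integral2 y)) has_real_derivative Im S * exp (u t) / radicand t) (at t within {0..2 * T})"
    and "(integral3 has_real_derivative - 2 * Im S * (exp (u t))\<^sup>2 / radicand t) (at t within {0..2 * T})"
proof -
  have den: "cnj S - S - of_real (exp (u y)) * of_real (deriv u y) \<noteq> 0" for y
    using S by (simp add: complex_eq_iff)
  have rad: "radicand y \<noteq> 0" for y
    using S by (simp add: radicand_def sum_power2_eq_zero_iff)
  note cont = continuous_intros continuous_u
  have "(integral1 has_vector_derivative (2 * \<i> * cnj S - \<i> * of_real (deriv u t) * of_real (exp (u t)))
      / (cnj S - S - of_real (exp (u t)) * of_real (deriv u t))) (at t within {0..2 * T})"
    unfolding integral1_def zero_ereal_def
    by (rule interval_integral_FTC2) (use den t in \<open>auto intro!: cont\<close>)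
  from bounded_linear.has_vector_derivative[OF bounded_linear_Re this]
  show "((\<lambda>y. Re (integral1 y)) has_real_derivative - Im S * Re S / radicand t) (at t within {0..2 * T})"
    unfolding integrand_parts(1)[OF S] has_real_derivative_iff_has_vector_derivative .
  have "(integral2 has_vector_derivative 2 * of_real (exp (u t))
      / (cnj S - S - of_real (exp (u t)) * of_real (deriv u t))) (at t within {0..2 * T})"
    unfolding integral2_def zero_ereal_def
    by (rule interval_integral_FTC2) (use den t in \<open>auto intro!: cont\<close>)
  from bounded_linear.has_vector_derivative[OF bounded_linear_Im this]
  show "((\<lambda>y. Im (integral2 y)) has_real_derivative Im S * exp (u t) / radicand t) (at t within {0..2 * T})"
    unfolding integrand_parts(2)[OF S] has_real_derivative_iff_has_vector_derivative .
  have "(integral3 has_vector_derivative - 2 * Im S * (exp (u t))\<^sup>2 / radicand t) (at t within {0..2 * T})"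
    unfolding integral3_def zero_ereal_def
    by (rule interval_integral_FTC2) (use rad t in \<open>auto intro!: cont simp: radicand_def\<close>)
  then show "(integral3 has_real_derivative - 2 * Im S * (exp (u t))\<^sup>2 / radicand t) (at t within {0..2 * T})"
    by (simp add: has_real_derivative_iff_has_vector_derivative)
qed

lemma integral_0: "integral1 0 = 0" "integral2 0 = 0" "integral3 0 = 0"
  by (simp_all add: integral1_def integral2_def integral3_def zero_ereal_def)

text \<open>For real \<open>S\<close> the integrands are purely imaginary and real, respectively. Pulling \<open>\<i>\<close> and the
  embedding of the reals out of the Lebesgue integral is valid regardless of integrability, which
  matters because the denominator has zeros.\<close>

lemma integral_parts_degenerate:
  assumes S: "Im S = 0"
  shows "Re (integral1 y) = 0" "Im (integral2 y) = 0"
proof -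
  have cnj: "cnj S = S" "of_real (Re S) = S"
    using S by (simp_all add: complex_eq_iff)
  have "integral1 y = (LBINT s=0..ereal y. \<i> * of_real ((2 * Re S - deriv u s * exp (u s))
      / (- exp (u s) * deriv u s)))"
    unfolding integral1_def by (simp add: cnj algebra_simps)
  then show "Re (integral1 y) = 0"
    by (simp only: interval_lebesgue_integral_mult_right interval_lebesgue_integral_of_real) simp
  have "integral2 y = (LBINT s=0..ereal y. of_real (2 * exp (u s) / (- exp (u s) * deriv u s)))"
    unfolding integral2_def by (simp add: cnj)
  then show "Im (integral2 y) = 0"
    by (simp only: interval_lebesgue_integral_of_real) simp
qed

text \<open>The factorisation of \<open>\<beta> E\<^sup>2 - 2 E\<^sup>3 - c\<^sup>2\<close> by the root \<open>E = \<kappa>\<close> that belongs to the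
  eigenvalue \<open>d\<close>.\<close>

lemma radicand_factor:
  assumes "d ^ 3 - energy * d + 2 * Re S = 0"
  shows "radicand y = (exp (u y) - (energy - d\<^sup>2) / 2) * (d\<^sup>2 * exp (u y) + Re S * d - 2 * (exp (u y))\<^sup>2)"
proof -
  have "\<beta> * E\<^sup>2 - 2 * E ^ 3 - c\<^sup>2 = (E - (\<beta> - d\<^sup>2) / 2) * (d\<^sup>2 * E + c * d - 2 * E\<^sup>2)"
    if "c = (\<beta> * d - d ^ 3) / 2" for \<beta> E c :: real
    unfolding that by (simp add: field_simps power2_eq_square power3_eq_cube)
  then show ?thesis
    unfolding radicand_def energy_quadratic using assms by simp
qed

text \<open>The function \<open>r\<^sup>2 / (E - \<kappa>)\<close> has logarithmic derivative \<open>2 i s / (E - \<kappa>)\<close>, and \<open>E - \<kappa>\<close> is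
  periodic, so over one period only the integral of \<open>s / (E - \<kappa>)\<close> remains. Working with the square of
  \<open>r\<close> avoids a choice of the branch of a logarithm or a root of \<open>E - \<kappa>\<close>.\<close>

lemma monodromy_square_generic:
  assumes V: "eigensolution d V"
    and \<tau>: "\<And>z. V (z + 2 * of_real T * \<i>) = \<tau> *s V z"
    and S: "Im S \<noteq> 0"
  shows "\<tau>\<^sup>2 = exp (\<i> * of_real (2 * (integral3 (2 * T)
    + d\<^sup>2 * Im (integral2 (2 * T)) - d * Re (integral1 (2 * T)))))"
proof -
  define \<kappa> where "\<kappa> = (energy - d\<^sup>2) / 2"
  define D where "D y = exp (u y) - \<kappa>" for y
  define G where "G y = integral3 y + d\<^sup>2 * Im (integral2 y) - d * Re (integral1 y)" for y
  define r where "r y = V (\<i> * of_real y) $ 3" for y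
  define Z where "Z y = exp (\<i> * of_real (- 2 * G y)) * (r y * r y * of_real (inverse (D y)))" for y
  have par: "parallel u S V" and cubic: "d ^ 3 - energy * d + 2 * Re S = 0"
    using V by (simp_all add: eigensolution_def)
  have ev: "lax_x u S y (V (\<i> * of_real y)) = (\<i> * of_real d) *s V (\<i> * of_real y)" for y
  proof -
    have "lax_x u S (Im (\<i> * of_real y)) (V (\<i> * of_real y)) = (\<i> * of_real d) *s V (\<i> * of_real y)"
      using V unfolding eigensolution_def by blast
    then show ?thesis
      by simp
  qed
  note eig = eigenvector_algebra[OF ev cubic disjI2[OF S], folded \<kappa>_def, folded D_def]
  have D: "D y \<noteq> 0" for y
    using eig(2)[of y] by (simp add: D_def)
  have const: "(Z has_vector_derivative 0) (at t within {0..2 * T})" if t: "t \<in> {0..2 * T}" for t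
  proof -
    define q where "q = d\<^sup>2 * exp (u t) + Re S * d - 2 * (exp (u t))\<^sup>2"
    have rad: "radicand t = D t * q"
      unfolding D_def \<kappa>_def q_def by (rule radicand_factor[OF cubic])
    have "radicand t \<noteq> 0"
      using S by (simp add: radicand_def sum_power2_eq_zero_iff)
    have "(G has_real_derivative - 2 * Im S * (exp (u t))\<^sup>2 / radicand t
        + d\<^sup>2 * (Im S * exp (u t) / radicand t) - d * (- Im S * Re S / radicand t)) (at t within {0..2 * T})"
      unfolding G_def by (intro DERIV_add DERIV_diff DERIV_cmult integral_derivatives[OF S t])
    \<comment> \<open>The three integrands add up to \<open>s q\<close> over the radicand, and the radicand is \<open>(E - \<kappa>) q\<close>.\<close>
    moreover have "- 2 * Im S * (exp (u t))\<^sup>2 / radicand t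
        + d\<^sup>2 * (Im S * exp (u t) / radicand t) - d * (- Im S * Re S / radicand t) = Im S * q / radicand t"
      using \<open>radicand t \<noteq> 0\<close> by (simp add: q_def field_simps)
    moreover have "Im S * q / radicand t = Im S / D t"
      using \<open>radicand t \<noteq> 0\<close> by (simp add: rad)
    ultimately have "(G has_real_derivative Im S / D t) (at t within {0..2 * T})"
      by simp
    then have "((\<lambda>y. - 2 * G y) has_real_derivative - 2 * (Im S / D t)) (at t within {0..2 * T})"
      by (rule DERIV_cmult)
    note phase = has_vector_derivative_phase[OF this]
    define r' where "r' = lax_y u S t (V (\<i> * of_real t)) $ 3"
    have dr: "(r has_vector_derivative r') (at t within {0..2 * T})"
      unfolding r_def r'_def
      by (rule has_vector_derivative_at_within
          [OF bounded_linear.has_vector_derivative[OF bounded_linear_vec_nth parallel_along_y[OF par]]])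
    have r': "r' = (of_real (deriv u t / 2 * exp (u t)) + \<i> * of_real (Im S)) * r t / of_real (D t)"
      using eig(1)[of t] D[of t] by (simp add: r'_def r_def eq_divide_eq mult.commute)
    have "(D has_real_derivative deriv u t * exp (u t)) (at t within {0..2 * T})"
      unfolding D_def by (auto intro!: derivative_eq_intros has_field_derivative_at_within[OF u_deriv])
    from DERIV_inverse'[OF this D]
    have "((\<lambda>y. complex_of_real (inverse (D y))) has_vector_derivative
        of_real (- (inverse (D t) * (deriv u t * exp (u t)) * inverse (D t)))) (at t within {0..2 * T})"
      by (intro has_vector_derivative_of_real)
         (simp add: has_real_derivative_iff_has_vector_derivative)
    from has_vector_derivative_mult[OF phase has_vector_derivative_mult[OF has_vector_derivative_mult[OF dr dr] this]]
    have "(Z has_vector_derivative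
        exp (\<i> * of_real (- 2 * G t)) * (r t * r t * of_real (- (inverse (D t) * (deriv u t * exp (u t)) * inverse (D t)))
          + (r t * r' + r' * r t) * of_real (inverse (D t)))
        + \<i> * of_real (- 2 * (Im S / D t)) * exp (\<i> * of_real (- 2 * G t)) * (r t * r t * of_real (inverse (D t))))
        (at t within {0..2 * T})"
      unfolding Z_def .
    moreover have "r t * r t * of_real (- (inverse (D t) * (deriv u t * exp (u t)) * inverse (D t)))
          + (r t * r' + r' * r t) * of_real (inverse (D t))
        = - (\<i> * of_real (- 2 * (Im S / D t))) * (r t * r t * of_real (inverse (D t)))"
      unfolding r' using D[of t] by (simp add: field_simps)
    ultimately show ?thesis
      by simp
  qed
  obtain c where "\<And>t. t \<in> {0..2 * T} \<Longrightarrow> Z t = c"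
    using has_vector_derivative_zero_constant[OF convex_real_interval(5) const] by blast
  then have "Z (2 * T) = Z 0"
    using T_pos by simp
  moreover have "r (2 * T) = \<tau> * r 0"
    using \<tau>[of 0] by (simp add: r_def mult.commute)
  moreover have "D (2 * T) = D 0"
    using period[of 0] by (simp add: D_def)
  moreover have "r 0 \<noteq> 0"
    using eigensolution_third_nonzero[OF V, of 0] S by (simp add: r_def)
  ultimately have "exp (\<i> * of_real (- 2 * G (2 * T))) * \<tau>\<^sup>2 = 1"
    using D[of 0] by (simp add: Z_def G_def integral_0 power2_eq_square)
  moreover have "exp (\<i> * of_real (- 2 * G (2 * T))) = inverse (exp (\<i> * of_real (2 * G (2 * T))))"
    by (simp flip: exp_minus)
  ultimately have "\<tau>\<^sup>2 = exp (\<i> * of_real (2 * G (2 * T)))"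
    by (metis inverse_unique inverse_inverse_eq)
  then show ?thesis
    by (simp only: G_def)
qed

end

section \<open>Phases and roots of unity\<close>

definition root_of_unity :: "complex \<Rightarrow> bool"
  where "root_of_unity z \<longleftrightarrow> (\<exists>n>0. z ^ n = 1)"

text \<open>Dividing by \<open>2\<pi>\<close> turns the set of admissible phases into the field of rationals, so that its
  closure properties become available.\<close>

lemma root_of_unity_exp: "root_of_unity (exp (\<i> * of_real x)) \<longleftrightarrow> x / (2 * pi) \<in> \<rat>"
proof
  assume "root_of_unity (exp (\<i> * of_real x))"
  then obtain n :: nat where n: "n > 0" "exp (\<i> * of_real x) ^ n = 1"
    unfolding root_of_unity_def by blast
  then have "exp (of_nat n * (\<i> * of_real x)) = 1"
    by (simp only: exp_of_nat_mult)
  then obtain k :: int where "real n * x = of_int (2 * k) * pi"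
    by (auto simp: exp_eq_1)
  then have "x / (2 * pi) = of_int k / of_nat n"
    using n(1) by (simp add: field_simps)
  then show "x / (2 * pi) \<in> \<rat>"
    by simp
next
  assume "x / (2 * pi) \<in> \<rat>"
  then obtain a b :: int where b: "b > 0" and "x / (2 * pi) = of_int a / of_int b"
    by (elim Rats_cases') auto
  then have "real (nat b) * x = of_int (2 * a) * pi"
    by (simp add: field_simps)
  then have "exp (of_nat (nat b) * (\<i> * of_real x)) = 1"
    unfolding exp_eq_1 by auto
  then show "root_of_unity (exp (\<i> * of_real x))"
    using b unfolding root_of_unity_def exp_of_nat_mult by (intro exI[of _ "nat b"]) auto
qed

lemma root_of_unity_square: "root_of_unity (z\<^sup>2) \<longleftrightarrow> root_of_unity z"
proof
  assume "root_of_unity (z\<^sup>2)"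
  then obtain n where "n > 0" "(z\<^sup>2) ^ n = 1"
    unfolding root_of_unity_def by blast
  then show "root_of_unity z"
    unfolding root_of_unity_def by (intro exI[of _ "2 * n"]) (simp add: power_mult)
next
  assume "root_of_unity z"
  then obtain n where "n > 0" "z ^ n = 1"
    unfolding root_of_unity_def by blast
  then show "root_of_unity (z\<^sup>2)"
    unfolding root_of_unity_def by (intro exI[of _ n]) (simp add: power_commutes flip: power_mult, simp add: mult.commute[of 2] power_mult)
qed

lemma exp_imaginary_eq_iff:
  "exp (\<i> * of_real x) = exp (\<i> * of_real y) \<longleftrightarrow> (\<exists>n::int. x - y = 2 * pi * of_int n)"
proof -
  have "\<i> * of_real x = \<i> * of_real y + of_real (of_int (2 * n) * pi) * \<i> \<longleftrightarrow> x - y = 2 * pi * of_int n" for n :: int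
    by (auto simp: complex_eq_iff algebra_simps)
  then show ?thesis
    by (simp only: exp_eq)
qed

text \<open>A common phase makes \<open>3 d\<^sub>1 p\<close> and \<open>3 d\<^sub>2 p\<close> integral multiples of \<open>2\<pi>\<close>. Conversely a
  rational ratio allows a \<open>p\<close> for which all three phases are trivial. If \<open>d\<^sub>2 = 0\<close>, then
  \<open>d\<^sub>3 = - d\<^sub>1\<close>, so a common period exists, in agreement with the convention \<open>d\<^sub>1 / 0 = 0\<close>.\<close>

lemma common_phase_iff_rational:
  fixes d1 d2 d3 :: real
  assumes sum: "d1 + d2 + d3 = 0" and ne: "d2 \<noteq> d3"
  shows "(\<exists>p. p \<noteq> 0 \<and> exp (\<i> * of_real (d1 * p)) = exp (\<i> * of_real (d2 * p))
      \<and> exp (\<i> * of_real (d2 * p)) = exp (\<i> * of_real (d3 * p))) \<longleftrightarrow> d1 / d2 \<in> \<rat>"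
proof
  assume "\<exists>p. p \<noteq> 0 \<and> exp (\<i> * of_real (d1 * p)) = exp (\<i> * of_real (d2 * p))
      \<and> exp (\<i> * of_real (d2 * p)) = exp (\<i> * of_real (d3 * p))"
  then obtain p and n m :: int where p: "p \<noteq> 0" and n: "d1 * p - d2 * p = 2 * pi * of_int n"
    and m: "d2 * p - d3 * p = 2 * pi * of_int m"
    unfolding exp_imaginary_eq_iff by blast
  have d3: "d3 = - d1 - d2"
    using sum by simp
  have "3 * p * d1 = 2 * pi * of_int (m + 2 * n)" and "3 * p * d2 = 2 * pi * of_int (m - n)"
    using n m by (simp_all add: d3 algebra_simps)
  then have "(3 * p * d1) / (3 * p * d2) = of_int (m + 2 * n) / of_int (m - n)"
    by simp
  then have "d1 / d2 = of_int (m + 2 * n) / of_int (m - n)"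
    using p by simp
  then show "d1 / d2 \<in> \<rat>"
    by (metis Rats_divide Rats_of_int)
next
  assume "d1 / d2 \<in> \<rat>"
  have trivial: "exp (\<i> * of_real (2 * pi * of_int k)) = 1" for k :: int
    by (auto simp: exp_eq_1)
  obtain p and k1 k2 :: int where "p \<noteq> 0" "d1 * p = 2 * pi * of_int k1" "d2 * p = 2 * pi * of_int k2"
  proof (cases "d2 = 0")
    case True
    then have "d1 \<noteq> 0"
      using sum ne by auto
    with True show thesis
      by (intro that[of "2 * pi / d1" 1 0]) auto
  next
    case False
    from \<open>d1 / d2 \<in> \<rat>\<close> obtain a b :: int where "b > 0" and "d1 / d2 = of_int a / of_int b"
      by (elim Rats_cases') auto
    with False show thesis
      by (intro that[of "2 * pi * of_int b / d2" a b]) (auto simp: field_simps)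
  qed
  moreover from this have "d3 * p = 2 * pi * of_int (- k1 - k2)"
    using sum by (simp add: algebra_simps) (metis add.commute add_eq_0_iff distrib_right mult_zero_left)
  ultimately have "p \<noteq> 0 \<and> exp (\<i> * of_real (d1 * p)) = exp (\<i> * of_real (d2 * p))
      \<and> exp (\<i> * of_real (d2 * p)) = exp (\<i> * of_real (d3 * p))"
    by (simp only: trivial) simp
  then show "\<exists>p. p \<noteq> 0 \<and> exp (\<i> * of_real (d1 * p)) = exp (\<i> * of_real (d2 * p))
      \<and> exp (\<i> * of_real (d2 * p)) = exp (\<i> * of_real (d3 * p))"
    by blast
qed

text \<open>A common value of the powers has cube \<open>1\<close> because the product of the three numbers is
  \<open>1\<close>.\<close>

lemma common_power_iff_roots_of_unity:
  fixes \<tau>1 \<tau>2 \<tau>3 :: complex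
  assumes prod: "\<tau>1 * \<tau>2 * \<tau>3 = 1"
  shows "(\<exists>m::int. m \<noteq> 0 \<and> \<tau>1 powi m = \<tau>2 powi m \<and> \<tau>2 powi m = \<tau>3 powi m)
    \<longleftrightarrow> root_of_unity \<tau>1 \<and> root_of_unity \<tau>2 \<and> root_of_unity \<tau>3"
proof
  assume "\<exists>m::int. m \<noteq> 0 \<and> \<tau>1 powi m = \<tau>2 powi m \<and> \<tau>2 powi m = \<tau>3 powi m"
  then obtain m :: int where m: "m \<noteq> 0" "\<tau>1 powi m = \<tau>2 powi m" "\<tau>2 powi m = \<tau>3 powi m"
    by blast
  have "\<tau>1 powi m * \<tau>2 powi m * \<tau>3 powi m = 1"
    using prod by (simp flip: power_int_mult_distrib)
  then have cube: "(\<tau>1 powi m) ^ 3 = 1" "(\<tau>2 powi m) ^ 3 = 1" "(\<tau>3 powi m) ^ 3 = 1"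
    using m(2,3) by (simp_all add: power3_eq_cube)
  have root: "root_of_unity \<tau>" if "(\<tau> powi m) ^ 3 = 1" for \<tau>
  proof -
    have "(\<tau> ^ nat \<bar>m\<bar>) ^ 3 = 1"
      using that by (auto simp: power_int_def abs_if power_inverse split: if_splits)
    then show ?thesis
      using m(1) unfolding root_of_unity_def power_mult[symmetric]
      by (intro exI[of _ "nat \<bar>m\<bar> * 3"]) auto
  qed
  show "root_of_unity \<tau>1 \<and> root_of_unity \<tau>2 \<and> root_of_unity \<tau>3"
    using cube root by blast
next
  assume "root_of_unity \<tau>1 \<and> root_of_unity \<tau>2 \<and> root_of_unity \<tau>3"
  then obtain a b c :: nat where "a > 0" "\<tau>1 ^ a = 1" "b > 0" "\<tau>2 ^ b = 1" "c > 0" "\<tau>3 ^ c = 1"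
    unfolding root_of_unity_def by blast
  define n where "n = a * b * c"
  have "n > 0"
    using \<open>a > 0\<close> \<open>b > 0\<close> \<open>c > 0\<close> by (simp add: n_def)
  moreover have "\<tau>1 ^ n = 1"
    using \<open>\<tau>1 ^ a = 1\<close> by (simp add: n_def power_mult)
  moreover have "\<tau>2 ^ n = 1"
    using \<open>\<tau>2 ^ b = 1\<close> by (simp add: n_def mult.commute[of a b] power_mult)
  moreover have "\<tau>3 ^ n = 1"
    using \<open>\<tau>3 ^ c = 1\<close> by (simp add: n_def mult.commute[of _ c] power_mult)
  ultimately show "\<exists>m::int. m \<noteq> 0 \<and> \<tau>1 powi m = \<tau>2 powi m \<and> \<tau>2 powi m = \<tau>3 powi m"
    by (intro exI[of _ "int n"]) simp
qed

text \<open>Multiplying the three squares gives \<open>1 = exp (6 i C)\<close>, so \<open>C\<close> is a rational multiple of \<open>2\<pi>\<close>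
  and drops out of the condition.\<close>

lemma roots_of_unity_iff_phases_rational:
  fixes \<Phi>1 \<Phi>2 \<Phi>3 C :: real
  assumes prod: "\<tau>1 * \<tau>2 * \<tau>3 = 1" and sum: "\<Phi>1 + \<Phi>2 + \<Phi>3 = 0"
    and sq: "\<tau>1\<^sup>2 = exp (\<i> * of_real (2 * (C - \<Phi>1)))"
      "\<tau>2\<^sup>2 = exp (\<i> * of_real (2 * (C - \<Phi>2)))"
      "\<tau>3\<^sup>2 = exp (\<i> * of_real (2 * (C - \<Phi>3)))"
  shows "root_of_unity \<tau>1 \<and> root_of_unity \<tau>2 \<and> root_of_unity \<tau>3
    \<longleftrightarrow> \<Phi>1 / (2 * pi) \<in> \<rat> \<and> \<Phi>2 / (2 * pi) \<in> \<rat>"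
proof -
  have "exp (\<i> * of_real (6 * C)) = \<tau>1\<^sup>2 * \<tau>2\<^sup>2 * \<tau>3\<^sup>2"
  proof -
    have "6 * C = 2 * (C - \<Phi>1) + 2 * (C - \<Phi>2) + 2 * (C - \<Phi>3)"
      using sum by simp
    then show ?thesis
      unfolding sq exp_add[symmetric] by (simp only: of_real_add distrib_left)
  qed
  also have "\<dots> = 1"
    using prod by (simp flip: power_mult_distrib)
  finally have "root_of_unity (exp (\<i> * of_real (6 * C)))"
    unfolding root_of_unity_def by (intro exI[of _ 1]) simp
  then have "6 * C / (2 * pi) / 6 \<in> \<rat>"
    unfolding root_of_unity_exp by (rule Rats_divide) simp
  then have C: "C / (2 * pi) \<in> \<rat>"
    by simp
  have root: "root_of_unity \<tau> \<longleftrightarrow> \<Phi> / (2 * pi) \<in> \<rat>"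
    if "\<tau>\<^sup>2 = exp (\<i> * of_real (2 * (C - \<Phi>)))" for \<tau> \<Phi>
  proof -
    have "root_of_unity \<tau> \<longleftrightarrow> 2 * (C - \<Phi>) / (2 * pi) \<in> \<rat>"
      by (simp only: root_of_unity_square[of \<tau>, symmetric] that root_of_unity_exp)
    also have "2 * (C - \<Phi>) / (2 * pi) = 2 * (C / (2 * pi) - \<Phi> / (2 * pi))"
      by (simp add: field_simps)
    also have "\<dots> \<in> \<rat> \<longleftrightarrow> \<Phi> / (2 * pi) \<in> \<rat>"
    proof
      assume "2 * (C / (2 * pi) - \<Phi> / (2 * pi)) \<in> \<rat>"
      then have "C / (2 * pi) - 2 * (C / (2 * pi) - \<Phi> / (2 * pi)) / 2 \<in> \<rat>"
        by (intro Rats_diff[OF C] Rats_divide[of _ 2]) auto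
      then show "\<Phi> / (2 * pi) \<in> \<rat>"
        by (simp only: nonzero_mult_div_cancel_left[OF zero_neq_numeral[symmetric]]) simp
    next
      assume "\<Phi> / (2 * pi) \<in> \<rat>"
      then show "2 * (C / (2 * pi) - \<Phi> / (2 * pi)) \<in> \<rat>"
        by (intro Rats_mult Rats_diff[OF C]) auto
    qed
    finally show ?thesis .
  qed
  have "\<Phi>3 / (2 * pi) \<in> \<rat>" if "\<Phi>1 / (2 * pi) \<in> \<rat>" "\<Phi>2 / (2 * pi) \<in> \<rat>"
  proof -
    have "\<Phi>3 = - \<Phi>1 - \<Phi>2"
      using sum by simp
    then have "\<Phi>3 / (2 * pi) = - (\<Phi>1 / (2 * pi)) - \<Phi>2 / (2 * pi)"
      by (simp add: diff_divide_distrib)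
    with that show ?thesis
      by (metis Rats_diff Rats_minus_iff)
  qed
  then show ?thesis
    using root[OF sq(1)] root[OF sq(2)] root[OF sq(3)] by blast
qed

section \<open>Equivariant frames as solutions of the Lax pair\<close>

text \<open>The row vector \<open>w F\<close> in the gauge in which it solves the Lax pair.\<close>

definition frame_section :: "complex \<Rightarrow> (complex \<Rightarrow> complex^3^3) \<Rightarrow> complex^3 \<Rightarrow> complex \<Rightarrow> complex^3"
  where "frame_section lam F w z = vector
    [inverse lam * (w v* F z) $ 1, lam * (w v* F z) $ 2, (w v* F z) $ 3]"

lemma frame_section_eq_iff:
  assumes "lam \<noteq> 0"
  shows "frame_section lam F w z = c *s frame_section lam G v z' \<longleftrightarrow> w v* F z = c *s (v v* G z')"
  using assms by (auto simp: frame_section_def vec_eq_iff forall_3)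

text \<open>The frame equations prescribe Wirtinger derivatives; this recovers from them the real
  differential, whose partial derivatives in \<open>x\<close> and \<open>y\<close> are the sum of the two and \<open>i\<close> times
  their difference.\<close>

lemma frechet_derivative_wirtinger:
  assumes "g differentiable (at z)"
  shows "(g has_derivative (\<lambda>h. Re h *\<^sub>R (wirtinger_z g z + wirtinger_zbar g z)
    + Im h *\<^sub>R (\<i> * (wirtinger_z g z - wirtinger_zbar g z)))) (at z)"
proof -
  let ?g' = "frechet_derivative g (at z)"
  have g': "(g has_derivative ?g') (at z)"
    using assms frechet_derivative_works by blast
  then have lin: "linear ?g'"
    by (rule has_derivative_linear)
  have real_linear: "?g' = (\<lambda>h. Re h *\<^sub>R ?g' 1 + Im h *\<^sub>R ?g' \<i>)"
  proof
    fix h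
    have "?g' (Re h *\<^sub>R 1 + Im h *\<^sub>R \<i>) = Re h *\<^sub>R ?g' 1 + Im h *\<^sub>R ?g' \<i>"
      by (simp only: linear_add[OF lin] linear_scale[OF lin])
    moreover have "Re h *\<^sub>R 1 + Im h *\<^sub>R \<i> = h"
      by (simp add: complex_eq_iff)
    ultimately show "?g' h = Re h *\<^sub>R ?g' 1 + Im h *\<^sub>R ?g' \<i>"
      by simp
  qed
  have "wirtinger_z g z + wirtinger_zbar g z = ?g' 1"
    "\<i> * (wirtinger_z g z - wirtinger_zbar g z) = ?g' \<i>"
    by (simp_all add: wirtinger_z_def wirtinger_zbar_def field_simps)
  then show ?thesis
    using has_derivative_eq_rhs[OF g' real_linear] by (simp only:)
qed

lemma wirtinger_of_height_function:
  assumes "(u has_real_derivative u') (at (Im z))"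
  shows "wirtinger_z (\<lambda>w. of_real (u (Im w))) z = - \<i> * of_real u' / 2"
    and "wirtinger_zbar (\<lambda>w. of_real (u (Im w))) z = \<i> * of_real u' / 2"
proof -
  have "(Im has_derivative Im) (at z)"
    using bounded_linear.has_derivative[OF bounded_linear_Im has_derivative_ident] .
  from has_derivative_of_real[OF has_derivative_compose[OF this assms[unfolded has_field_derivative_def]]]
  have "frechet_derivative (\<lambda>w. complex_of_real (u (Im w))) (at z) = (\<lambda>h. of_real (u' * Im h))"
    by (rule frechet_derivative_at[symmetric])
  then show "wirtinger_z (\<lambda>w. of_real (u (Im w))) z = - \<i> * of_real u' / 2"
    "wirtinger_zbar (\<lambda>w. of_real (u (Im w))) z = \<i> * of_real u' / 2"
    by (simp_all add: wirtinger_z_def wirtinger_zbar_def)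
qed

lemma SU3_invertible: "A \<in> SU3 \<Longrightarrow> invertible A"
  by (simp add: SU3_def invertible_det_nz)

lemma mult_matrix_inv: "invertible A \<Longrightarrow> A ** matrix_inv A = mat 1"
  unfolding matrix_inv_def invertible_def by (drule someI_ex) simp

text \<open>Since \<open>F\<^sub>z = F A\<close> and similarly for the conjugate derivative with \<open>B\<close>, the row \<open>\<rho> = w F\<close> has
  \<open>\<rho>\<^sub>x = \<rho> (A + B)\<close> and \<open>\<rho>\<^sub>y = i \<rho> (A - B)\<close>. In \<open>A - B\<close> the diagonal cancels, and conjugation with
  \<open>diag (\<lambda>\<^sup>-\<^sup>1, \<lambda>, 1)\<close> collects the powers of \<open>\<lambda>\<close> in \<open>S\<close>; this uses \<open>\<lambda>\<^sup>-\<^sup>1 = cnj \<lambda>\<close>.\<close>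

lemma parallel_frame_section:
  assumes frame: "is_frame \<psi> u lam F" and lam: "cmod lam = 1"
    and u: "\<And>y. (u has_real_derivative deriv u y) (at y)"
  shows "parallel u (lam powi (-3) * \<psi>) (frame_section lam F w)"
  unfolding parallel_def has_derivative_complex3_iff forall_3
proof
  fix z
  define A B where "A = frame_coeff_z \<psi> u lam z" and "B = frame_coeff_zbar \<psi> u lam z"
  define \<rho> where "\<rho> = w v* F z"
  have inv: "invertible (F z)" and diff: "F differentiable (at z)"
    and A: "matrix_inv (F z) ** matrix_wirtinger_z F z = A"
    and B: "matrix_inv (F z) ** matrix_wirtinger_zbar F z = B"
    using frame by (auto simp: is_frame_def SU3_invertible A_def B_def)
  have FA: "matrix_wirtinger_z F z = F z ** A" and FB: "matrix_wirtinger_zbar F z = F z ** B"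
    using inv by (simp_all add: A[symmetric] B[symmetric] matrix_mul_assoc mult_matrix_inv)
  have entry: "((\<lambda>z. F z $ i $ k) has_derivative (\<lambda>h. Re h *\<^sub>R ((F z ** A) $ i $ k + (F z ** B) $ i $ k)
      + Im h *\<^sub>R (\<i> * ((F z ** A) $ i $ k - (F z ** B) $ i $ k)))) (at z)" for i k
  proof -
    have "(\<lambda>z. F z $ i $ k) differentiable (at z)"
    proof -
      obtain D where "(F has_derivative D) (at z)"
        using diff unfolding differentiable_def by blast
      from bounded_linear.has_derivative[OF bounded_linear_vec_nth[of k]
          bounded_linear.has_derivative[OF bounded_linear_vec_nth[of i] this]]
      show ?thesis
        unfolding differentiable_def by blast
    qed
    from frechet_derivative_wirtinger[OF this] show ?thesis
      by (simp flip: FA FB add: matrix_wirtinger_z_def matrix_wirtinger_zbar_def)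
  qed
  have row: "((\<lambda>z. (w v* F z) $ k) has_derivative (\<lambda>h. Re h *\<^sub>R ((\<rho> v* A) $ k + (\<rho> v* B) $ k)
      + Im h *\<^sub>R (\<i> * ((\<rho> v* A) $ k - (\<rho> v* B) $ k)))) (at z)" for k
  proof -
    have "((\<lambda>z. \<Sum>i\<in>UNIV. w $ i * F z $ i $ k) has_derivative (\<lambda>h. \<Sum>i\<in>UNIV. w $ i *
        (Re h *\<^sub>R ((F z ** A) $ i $ k + (F z ** B) $ i $ k)
          + Im h *\<^sub>R (\<i> * ((F z ** A) $ i $ k - (F z ** B) $ i $ k))))) (at z)"
      by (intro has_derivative_sum has_derivative_mult_right entry)
    moreover have "(\<Sum>i\<in>UNIV. w $ i * (a *\<^sub>R ((F z ** A) $ i $ k + (F z ** B) $ i $ k)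
          + b *\<^sub>R (\<i> * ((F z ** A) $ i $ k - (F z ** B) $ i $ k))))
        = a *\<^sub>R ((w v* (F z ** A)) $ k + (w v* (F z ** B)) $ k)
          + b *\<^sub>R (\<i> * ((w v* (F z ** A)) $ k - (w v* (F z ** B)) $ k))" for a b
      by (simp add: vector_matrix_mult_def sum_3 scaleR_conv_of_real algebra_simps)
    ultimately show ?thesis
      unfolding \<rho>_def vector_matrix_mul_assoc by (simp add: vector_matrix_mult_def)
  qed
  define h g e where "h = complex_of_real (deriv u (Im z) / 2)" and "g = complex_of_real (exp (- u (Im z)))"
    and "e = complex_of_real (exp (u (Im z) / 2))"
  have lam0: "lam \<noteq> 0" and cnj_lam: "cnj lam = inverse lam"
    using lam by (auto simp: inverse_eq_divide divide_conv_cnj)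
  then have lam_inv: "lam * inverse lam = 1"
    by simp
  define h2 where "h2 = h / 2"
  have h: "h = 2 * h2" and ii: "\<i> * \<i> = -1"
    by (simp_all add: h2_def)
  define S where "S = lam powi (-3) * \<psi>"
  have S: "S = inverse lam * inverse lam * inverse lam * \<psi>"
    "cnj S = lam * lam * lam * cnj \<psi>"
    by (simp_all add: S_def power_int_def power3_eq_cube cnj_lam)
  have A_rows: "A = vector [vector [- \<i> * h2, 0, inverse lam * (\<i> * e)],
      vector [inverse lam * (- \<i> * \<psi> * g), \<i> * h2, 0], vector [0, inverse lam * (\<i> * e), 0]]"
    unfolding A_def frame_coeff_z_def Let_def wirtinger_of_height_function(1)[OF u]
      vec_eq_iff forall_3 map_matrix_def
    by (simp add: h2_def h_def g_def e_def)
  have B_rows: "B = vector [vector [- \<i> * h2, lam * (- \<i> * cnj \<psi> * g), 0],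
      vector [0, \<i> * h2, lam * (\<i> * e)], vector [lam * (\<i> * e), 0, 0]]"
    unfolding B_def frame_coeff_zbar_def Let_def wirtinger_of_height_function(2)[OF u]
      vec_eq_iff forall_3 map_matrix_def
    by (simp add: h2_def h_def g_def e_def)
  note unf = frame_section_def lax_x_def lax_y_def vector_3 S_def[symmetric]
    h_def[symmetric] g_def[symmetric] e_def[symmetric] \<rho>_def[symmetric]
  have comps: "(\<rho> v* A) $ 1 = \<rho> $ 1 * (- \<i> * h2) + \<rho> $ 2 * (inverse lam * (- \<i> * \<psi> * g))"
    "(\<rho> v* A) $ 2 = \<rho> $ 2 * (\<i> * h2) + \<rho> $ 3 * (inverse lam * (\<i> * e))"
    "(\<rho> v* A) $ 3 = \<rho> $ 1 * (inverse lam * (\<i> * e))"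
    "(\<rho> v* B) $ 1 = \<rho> $ 1 * (- \<i> * h2) + \<rho> $ 3 * (lam * (\<i> * e))"
    "(\<rho> v* B) $ 2 = \<rho> $ 1 * (lam * (- \<i> * cnj \<psi> * g)) + \<rho> $ 2 * (\<i> * h2)"
    "(\<rho> v* B) $ 3 = \<rho> $ 2 * (lam * (\<i> * e))"
    by (simp_all add: A_rows B_rows vector_matrix_mult_def sum_3 mult.commute)
  have d1: "((\<lambda>z. inverse lam * (w v* F z) $ 1) has_derivative (\<lambda>k. inverse lam *
      (Re k *\<^sub>R ((\<rho> v* A) $ 1 + (\<rho> v* B) $ 1) + Im k *\<^sub>R (\<i> * ((\<rho> v* A) $ 1 - (\<rho> v* B) $ 1))))) (at z)"
    by (rule has_derivative_mult_right[OF row])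
  have d2: "((\<lambda>z. lam * (w v* F z) $ 2) has_derivative (\<lambda>k. lam *
      (Re k *\<^sub>R ((\<rho> v* A) $ 2 + (\<rho> v* B) $ 2) + Im k *\<^sub>R (\<i> * ((\<rho> v* A) $ 2 - (\<rho> v* B) $ 2))))) (at z)"
    by (rule has_derivative_mult_right[OF row])
  show "((\<lambda>x. frame_section lam F w x $ 1) has_derivative (\<lambda>k. (Re k *\<^sub>R lax_x u (lam powi (-3) * \<psi>) (Im z) (frame_section lam F w z)
      + Im k *\<^sub>R lax_y u (lam powi (-3) * \<psi>) (Im z) (frame_section lam F w z)) $ 1)) (at z) \<and>
    ((\<lambda>x. frame_section lam F w x $ 2) has_derivative (\<lambda>k. (Re k *\<^sub>R lax_x u (lam powi (-3) * \<psi>) (Im z) (frame_section lam F w z)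
      + Im k *\<^sub>R lax_y u (lam powi (-3) * \<psi>) (Im z) (frame_section lam F w z)) $ 2)) (at z) \<and>
    ((\<lambda>x. frame_section lam F w x $ 3) has_derivative (\<lambda>k. (Re k *\<^sub>R lax_x u (lam powi (-3) * \<psi>) (Im z) (frame_section lam F w z)
      + Im k *\<^sub>R lax_y u (lam powi (-3) * \<psi>) (Im z) (frame_section lam F w z)) $ 3)) (at z)"
    unfolding vector_add_component vector_scaleR_component unf
    apply (intro conjI)
      apply (rule has_derivative_eq_rhs[OF d1], rule ext)
    subgoal for k unfolding comps scaleR_conv_of_real using lam_inv ii S unfolding h by algebra
     apply (rule has_derivative_eq_rhs[OF d2], rule ext)
    subgoal for k unfolding comps scaleR_conv_of_real using lam_inv ii S unfolding h by algebra
    apply (rule has_derivative_eq_rhs[OF row], rule ext)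
    subgoal for k unfolding comps scaleR_conv_of_real using lam_inv ii S unfolding h by algebra
    done
qed

section \<open>Linear algebra and the projective plane\<close>

lemma vector_matrix_mult_diff: "w v* (A - B) = w v* A - w v* B" for A B :: "'a::comm_ring_1^'n^'m"
  by (simp add: vector_matrix_mult_def vec_eq_iff sum_subtractf right_diff_distrib)

lemma vector_mat_scalar: "w v* mat \<mu> = \<mu> *s w" for w :: "'a::comm_ring_1^'n"
  by (simp add: vector_matrix_mult_def mat_def vec_eq_iff if_distrib cong: if_cong)

lemma left_kernel:
  fixes A :: "'a::field^'n^'n"
  assumes "det A = 0"
  obtains w where "w \<noteq> 0" "w v* A = 0"
proof -
  have "\<not> invertible (transpose A)"
    using assms by (simp add: invertible_det_nz)
  then have "\<not> (\<exists>B. B ** transpose A = mat 1)"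
    by (simp add: invertible_left_inverse)
  then show thesis
    using that unfolding matrix_left_invertible_ker by auto
qed

text \<open>A relation \<open>\<Sum> x\<^sub>j w\<^sub>j = 0\<close> persists when \<open>D\<close> is applied once or twice, which multiplies the
  summands by the powers of their eigenvalues. Vandermonde elimination then isolates each summand.\<close>

lemma left_eigenvectors_independent:
  fixes D :: "complex^3^3"
  assumes ev: "w1 v* D = c1 *s w1" "w2 v* D = c2 *s w2" "w3 v* D = c3 *s w3"
    and nz: "w1 \<noteq> 0" "w2 \<noteq> 0" "w3 \<noteq> 0"
    and ne: "c1 \<noteq> c2" "c1 \<noteq> c3" "c2 \<noteq> c3"
  shows "det (vector [w1, w2, w3] :: complex^3^3) \<noteq> 0"
proof
  assume "det (vector [w1, w2, w3] :: complex^3^3) = 0"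
  then obtain x :: "complex^3" where x: "x \<noteq> 0" "x v* vector [w1, w2, w3] = 0"
    by (rule left_kernel)
  have comb: "x $ 1 *s w1 + x $ 2 *s w2 + x $ 3 *s w3 = 0"
    using x(2) by (simp add: vector_matrix_mult_def vec_eq_iff sum_3 mult.commute)
  have apply_D: "(a * c1) *s w1 + (b * c2) *s w2 + (c * c3) *s w3 = 0"
    if "a *s w1 + b *s w2 + c *s w3 = 0" for a b c
  proof -
    have "(a *s w1 + b *s w2 + c *s w3) v* D = a *s (w1 v* D) + b *s (w2 v* D) + c *s (w3 v* D)"
      by (simp add: vector_matrix_mult_def vec_eq_iff sum_3 algebra_simps)
    then show ?thesis
      unfolding that ev by (simp add: vec_eq_iff vector_matrix_mult_def mult.assoc)
  qed
  note e0 = comb and e1 = apply_D[OF comb] and e2 = apply_D[OF apply_D[OF comb]]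
  have "x $ 1 * (c1 - c2) * (c1 - c3) * w1 $ i = 0 \<and> x $ 2 * (c2 - c1) * (c2 - c3) * w2 $ i = 0
      \<and> x $ 3 * (c3 - c1) * (c3 - c2) * w3 $ i = 0" for i
  proof -
    have "x $ 1 * w1 $ i + x $ 2 * w2 $ i + x $ 3 * w3 $ i = 0"
      "x $ 1 * c1 * w1 $ i + x $ 2 * c2 * w2 $ i + x $ 3 * c3 * w3 $ i = 0"
      "x $ 1 * c1 * c1 * w1 $ i + x $ 2 * c2 * c2 * w2 $ i + x $ 3 * c3 * c3 * w3 $ i = 0"
      using e0 e1 e2 by (simp_all add: vec_eq_iff)
    then show ?thesis
      by (intro conjI; algebra)
  qed
  then have "(x $ 1 * (c1 - c2) * (c1 - c3)) *s w1 = 0"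
    "(x $ 2 * (c2 - c1) * (c2 - c3)) *s w2 = 0"
    "(x $ 3 * (c3 - c1) * (c3 - c2)) *s w3 = 0"
    by (simp_all add: vec_eq_iff)
  then have "x $ 1 = 0 \<and> x $ 2 = 0 \<and> x $ 3 = 0"
    using nz ne by (simp add: vector_mul_eq_0)
  with x(1) show False
    by (simp add: vec_eq_iff forall_3)
qed

lemma det_scaled_rows_3:
  "det (vector [a *s x, b *s y, c *s z] :: complex^3^3) = a * b * c * det (vector [x, y, z] :: complex^3^3)"
  by (simp add: det_3 algebra_simps)

lemma cp2_class_eq_iff:
  assumes "v \<noteq> 0" "w \<noteq> 0"
  shows "cp2_class v = cp2_class w \<longleftrightarrow> (\<exists>c. v = c *s w)"
proof -
  have "cp2_class v = cp2_class w \<longleftrightarrow> range (\<lambda>c. c *s v) = range (\<lambda>c. c *s w)"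
    unfolding cp2_class_def using assms by (intro Abs_cp2_inject) blast+
  also have "\<dots> \<longleftrightarrow> (\<exists>c. v = c *s w)"
  proof
    assume eq: "range (\<lambda>c. c *s v) = range (\<lambda>c. c *s w)"
    have "1 *s v \<in> range (\<lambda>c. c *s v)"
      by (rule rangeI)
    then have "v \<in> range (\<lambda>c. c *s w)"
      unfolding eq by simp
    then show "\<exists>c. v = c *s w"
      by blast
  next
    assume "\<exists>c. v = c *s w"
    then obtain c where c: "v = c *s w"
      by blast
    with assms have "c \<noteq> 0"
      by auto
    have "t *s v = (t * c) *s w" "t *s w = (t / c) *s v" for t
      using \<open>c \<noteq> 0\<close> by (simp_all add: c vec_eq_iff)
    then show "range (\<lambda>c. c *s v) = range (\<lambda>c. c *s w)"
      by (metis (no_types, lifting) image_subset_iff rangeI subset_antisym)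
  qed
  finally show ?thesis .
qed

text \<open>The products with the independent rows \<open>w\<^sub>j\<close> are homogeneous coordinates of the surface.
  The translation acts on them diagonally, so equal multipliers mean an unchanged point, and at
  \<open>z\<^sub>0\<close>, where no coordinate vanishes, an unchanged point forces equal multipliers.\<close>

lemma surface_translation_iff:
  fixes F :: "complex \<Rightarrow> complex^3^3" and w1 w2 w3 :: "complex^3"
  assumes det_F: "\<And>z. det (F z) = 1"
    and det_W: "det (vector [w1, w2, w3] :: complex^3^3) \<noteq> 0"
    and \<tau>: "\<And>z. (w1 v* F (z + \<omega>)) $ 3 = \<tau>1 * (w1 v* F z) $ 3"
      "\<And>z. (w2 v* F (z + \<omega>)) $ 3 = \<tau>2 * (w2 v* F z) $ 3"
      "\<And>z. (w3 v* F (z + \<omega>)) $ 3 = \<tau>3 * (w3 v* F z) $ 3"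
    and generic: "(w1 v* F z0) $ 3 \<noteq> 0" "(w2 v* F z0) $ 3 \<noteq> 0" "(w3 v* F z0) $ 3 \<noteq> 0"
  shows "(\<forall>z. surface_of_frame F (z + \<omega>) = surface_of_frame F z) \<longleftrightarrow> \<tau>1 = \<tau>2 \<and> \<tau>2 = \<tau>3"
proof -
  define W :: "complex^3^3" where "W = vector [w1, w2, w3]"
  define e where "e = (axis 3 1 :: complex^3)"
  have W: "W *v (F z *v e) = vector [(w1 v* F z) $ 3, (w2 v* F z) $ 3, (w3 v* F z) $ 3]" for z
    by (simp add: W_def e_def vec_eq_iff forall_3 matrix_vector_mult_def vector_matrix_mult_def
        sum_3 axis_def mult.commute)
  have inj_W: "W *v x = W *v y \<Longrightarrow> x = y" for x y
    using inj_matrix_vector_mult[of W] det_W by (simp add: W_def invertible_det_nz inj_def)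
  have F_e: "F z *v e \<noteq> 0" for z
  proof
    assume "F z *v e = 0"
    then have "F z *v e = F z *v 0"
      by simp
    then have "e = 0"
      using inj_matrix_vector_mult[of "F z"] det_F[of z] by (simp add: invertible_det_nz inj_def)
    then show False
      by (simp add: e_def axis_eq_0_iff)
  qed
  have surface: "surface_of_frame F z = surface_of_frame F z' \<longleftrightarrow> (\<exists>c. W *v (F z *v e) = c *s (W *v (F z' *v e)))" for z z'
    unfolding surface_of_frame_def e_def[symmetric] cp2_class_eq_iff[OF F_e F_e]
    using inj_W by (metis vector_scalar_commute)
  show ?thesis
  proof
    assume "\<forall>z. surface_of_frame F (z + \<omega>) = surface_of_frame F z"
    then obtain c where "W *v (F (z0 + \<omega>) *v e) = c *s (W *v (F z0 *v e))"
      using surface by blast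
    then have "\<tau>1 = c \<and> \<tau>2 = c \<and> \<tau>3 = c"
      unfolding W using generic by (simp add: \<tau> vec_eq_iff forall_3)
    then show "\<tau>1 = \<tau>2 \<and> \<tau>2 = \<tau>3"
      by simp
  next
    assume "\<tau>1 = \<tau>2 \<and> \<tau>2 = \<tau>3"
    then have "W *v (F (z + \<omega>) *v e) = \<tau>1 *s (W *v (F z *v e))" for z
      unfolding W by (simp add: \<tau> vec_eq_iff forall_3)
    then show "\<forall>z. surface_of_frame F (z + \<omega>) = surface_of_frame F z"
      using surface by blast
  qed
qed

section \<open>The spectrum of the potential and the closing conditions\<close>

lemma rows_matrix_mult_3:
  "(vector [w1, w2, w3] :: complex^3^3) ** A = vector [w1 v* A, w2 v* A, w3 v* A]" for A :: "complex^3^3"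
  by (simp add: vec_eq_iff forall_3 matrix_matrix_mult_def vector_matrix_mult_def)

lemma potential_entries:
  "potential_D \<psi> u lam = vector
    [vector [0, lam * (- \<i> * cnj \<psi> * of_real (exp (- u 0))), inverse lam * (\<i> * of_real (exp (u 0 / 2)))],
     vector [inverse lam * (- \<i> * \<psi> * of_real (exp (- u 0))), 0, lam * (\<i> * of_real (exp (u 0 / 2)))],
     vector [lam * (\<i> * of_real (exp (u 0 / 2))), inverse lam * (\<i> * of_real (exp (u 0 / 2))), 0]]"
proof -
  have "(complex_of_real (exp (u 0 / 2)))\<^sup>2 = of_real (exp (u 0))"
    by (simp add: exp_double[symmetric] flip: of_real_power)
  then have "coeff_b \<psi> u = - \<i> * \<psi> * of_real (exp (- u 0))"
    by (simp add: coeff_b_def coeff_a_def power_mult_distrib exp_minus field_simps)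
  then show ?thesis
    by (simp add: potential_D_def Let_def coeff_a_def power_int_def)
qed

lemma beta_eq: "beta \<psi> u = 2 * exp (u 0) + (cmod \<psi>)\<^sup>2 * exp (- 2 * u 0)"
proof -
  have "(exp (u 0 / 2))\<^sup>2 = exp (u 0)" "(exp (u 0))\<^sup>2 * exp (- 2 * u 0) = 1"
    by (simp_all add: exp_double[symmetric] mult_exp_exp)
  moreover from this(2) have "exp (- 2 * u 0) = inverse ((exp (u 0))\<^sup>2)"
    by (simp add: field_simps)
  ultimately show ?thesis
    by (simp add: beta_def coeff_b_def coeff_a_def norm_mult norm_divide norm_power power_divide field_simps)
qed

text \<open>At the origin the frame is the identity and \<open>u' = 0\<close>, and there \<open>X\<close> is the gauge transform of
  the potential.\<close>

lemma frame_section_eigenvector_0: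
  assumes F: "F 0 = mat 1" and lam: "cmod lam = 1" and u': "deriv u 0 = 0"
    and ev: "w v* potential_D \<psi> u lam = c *s w"
  shows "lax_x u (lam powi (-3) * \<psi>) 0 (frame_section lam F w 0) = c *s frame_section lam F w 0"
proof -
  define g e where "g = complex_of_real (exp (- u 0))" and "e = complex_of_real (exp (u 0 / 2))"
  define S where "S = lam powi (-3) * \<psi>"
  have "lam \<noteq> 0" and cnj_lam: "cnj lam = inverse lam"
    using lam by (auto simp: inverse_eq_divide divide_conv_cnj)
  then have lam_inv: "lam * inverse lam = 1"
    by simp
  have S: "S = inverse lam * inverse lam * inverse lam * \<psi>" "cnj S = lam * lam * lam * cnj \<psi>"
    by (simp_all add: S_def power_int_def power3_eq_cube cnj_lam)
  have "w $ 2 * (inverse lam * (- \<i> * \<psi> * g)) + w $ 3 * (lam * (\<i> * e)) = c * w $ 1"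
    "w $ 1 * (lam * (- \<i> * cnj \<psi> * g)) + w $ 3 * (inverse lam * (\<i> * e)) = c * w $ 2"
    "w $ 1 * (inverse lam * (\<i> * e)) + w $ 2 * (lam * (\<i> * e)) = c * w $ 3"
    using ev unfolding potential_entries g_def[symmetric] e_def[symmetric]
    by (simp_all add: vec_eq_iff forall_3 vector_matrix_mult_def sum_3 mult.commute)
  then show ?thesis
    unfolding S_def[symmetric] lax_x_def frame_section_def vec_eq_iff forall_3 vector_3
      vector_smult_component F vector_matrix_mul_rid g_def[symmetric] e_def[symmetric] u'
    using lam_inv S by (simp only: div_0 of_real_0 mult_zero_right mult_zero_left) (intro conjI; algebra)
qed

lemma det_potential:
  assumes lam: "cmod lam = 1"
  shows "det (mat \<mu> - potential_D \<psi> u lam)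
    = \<mu> ^ 3 + of_real (beta \<psi> u) * \<mu> - 2 * \<i> * of_real (Re (lam powi (-3) * \<psi>))"
proof -
  define g e where "g = complex_of_real (exp (- u 0))" and "e = complex_of_real (exp (u 0 / 2))"
  define S where "S = lam powi (-3) * \<psi>"
  have "lam \<noteq> 0" and cnj_lam: "cnj lam = inverse lam"
    using lam by (auto simp: inverse_eq_divide divide_conv_cnj)
  then have lam_inv: "lam * inverse lam = 1"
    by simp
  have S: "S = inverse lam * inverse lam * inverse lam * \<psi>" "cnj S = lam * lam * lam * cnj \<psi>"
    by (simp_all add: S_def power_int_def power3_eq_cube cnj_lam)
  have eg: "e * e * g = 1"
    by (simp add: e_def g_def mult_exp_exp flip: of_real_mult)
  have "complex_of_real (exp (- 2 * u 0)) = g * g" "complex_of_real (exp (u 0)) = e * e"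
    by (simp_all add: g_def e_def mult_exp_exp flip: of_real_mult)
  then have beta: "complex_of_real (beta \<psi> u) = 2 * (e * e) + \<psi> * cnj \<psi> * (g * g)"
    unfolding beta_eq of_real_add of_real_mult complex_norm_square by simp
  have re: "2 * \<i> * of_real (Re S) = \<i> * (S + cnj S)"
    by (simp add: complex_add_cnj)
  have ii: "\<i> * \<i> = -1"
    by simp
  have mat: "mat \<mu> - potential_D \<psi> u lam = vector
    [vector [\<mu>, - (lam * (- \<i> * cnj \<psi> * g)), - (inverse lam * (\<i> * e))],
     vector [- (inverse lam * (- \<i> * \<psi> * g)), \<mu>, - (lam * (\<i> * e))],
     vector [- (lam * (\<i> * e)), - (inverse lam * (\<i> * e)), \<mu>]]"
    unfolding potential_entries g_def[symmetric] e_def[symmetric]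
    by (simp add: vec_eq_iff forall_3 mat_def)
  show ?thesis
    unfolding mat S_def[symmetric] re beta det_3 vector_3 using lam_inv S eg ii by algebra
qed

text \<open>Comparing values at \<open>0\<close> and \<open>1\<close> suffices, since real and imaginary parts separate the
  coefficients.\<close>

lemma imaginary_roots_symmetric_functions:
  fixes d1 d2 d3 \<beta> c :: real
  assumes "\<And>\<mu>::complex. \<mu> ^ 3 + of_real \<beta> * \<mu> - 2 * \<i> * of_real c
    = (\<mu> - \<i> * of_real d1) * (\<mu> - \<i> * of_real d2) * (\<mu> - \<i> * of_real d3)"
  shows "d1 + d2 + d3 = 0" "d1 * d2 + d2 * d3 + d3 * d1 = - \<beta>" "d1 * d2 * d3 = - 2 * c"
proof -
  show p: "d1 * d2 * d3 = - 2 * c"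
    using arg_cong[OF assms[of 0], of Im] by (simp add: algebra_simps)
  have "1 + \<beta> = 1 - (d1 * d2 + d2 * d3 + d3 * d1)"
    using arg_cong[OF assms[of 1], of Re] by (simp add: algebra_simps)
  then show "d1 * d2 + d2 * d3 + d3 * d1 = - \<beta>"
    by simp
  have "- 2 * c = - (d1 + d2 + d3) + d1 * d2 * d3"
    using arg_cong[OF assms[of 1], of Im] by (simp add: algebra_simps)
  with p show "d1 + d2 + d3 = 0"
    by simp
qed

context periodic_tzitzeica
begin

text \<open>A double eigenvalue \<open>a\<close> forces \<open>\<beta> = 3 a\<^sup>2\<close> and \<open>c = a\<^sup>3\<close>, for which the first integral becomes
  \<open>(E u'/2)\<^sup>2 + s\<^sup>2 = - (E - a\<^sup>2)\<^sup>2 (2 E + a\<^sup>2)\<close>. This is impossible at a height where \<open>u' \<noteq> 0\<close>.\<close>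

lemma eigenvalues_distinct:
  assumes "a + b + c = 0" "a * b + b * c + c * a = - energy" "a * b * c = - 2 * Re S"
  shows "a \<noteq> b"
proof
  assume "a = b"
  then have c: "c = - 2 * a"
    using assms(1) by simp
  have energy: "energy = 3 * a\<^sup>2"
    using assms(2) unfolding \<open>a = b\<close>[symmetric] c by (simp add: power2_eq_square)
  have S: "Re S = a ^ 3"
    using assms(3) unfolding \<open>a = b\<close>[symmetric] c by (simp add: power3_eq_cube)
  obtain y where "deriv u y \<noteq> 0"
    using nonconst by blast
  then have "0 < (deriv u y / 2 * exp (u y))\<^sup>2 + (Im S)\<^sup>2"
    by (intro add_pos_nonneg) auto
  also have "\<dots> = - ((exp (u y) - a\<^sup>2)\<^sup>2 * (2 * exp (u y) + a\<^sup>2))"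
    unfolding energy_quadratic energy S by algebra
  also have "\<dots> \<le> 0"
    by simp
  finally show False
    by simp
qed

lemma monodromy_power:
  assumes V: "eigensolution d V" and \<tau>: "\<And>z. V (z + 2 * of_real T * \<i>) = \<tau> *s V z"
  shows "V (z + of_int m * (2 * of_real T * \<i>)) = (\<tau> powi m) *s V z"
proof -
  have nat: "V (z + of_nat n * (2 * of_real T * \<i>)) = (\<tau> ^ n) *s V z" for n z
  proof (induction n)
    case (Suc n)
    have "V (z + of_nat (Suc n) * (2 * of_real T * \<i>))
        = V (z + of_nat n * (2 * of_real T * \<i>) + 2 * of_real T * \<i>)"
      by (simp add: algebra_simps)
    then show ?case
      by (simp add: \<tau> Suc.IH)
  qed simp
  have "\<tau> \<noteq> 0"
    using \<tau>[of 0] eigensolution_nonzero[OF V] by auto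
  show ?thesis
  proof (cases "m \<ge> 0")
    case True
    then show ?thesis
      using nat[of z "nat m"] by (simp add: power_int_def)
  next
    case False
    have "V z = (\<tau> ^ nat (- m)) *s V (z + of_int m * (2 * of_real T * \<i>))"
      using nat[of "z + of_int m * (2 * of_real T * \<i>)" "nat (- m)"] False by (simp add: algebra_simps)
    then have "(inverse \<tau> ^ nat (- m)) *s V z = V (z + of_int m * (2 * of_real T * \<i>))"
      using \<open>\<tau> \<noteq> 0\<close> by (simp add: power_inverse)
    then show ?thesis
      using False by (simp add: power_int_def)
  qed
qed

text \<open>The common form of both cases. With \<open>\<Phi>\<close> the expression in the closing condition, the phase of
  \<open>\<tau>\<close> is \<open>C - \<Phi>\<close>, where \<open>C\<close> is the same for all eigenvalues.\<close>

lemma monodromy_square: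
  obtains C where "\<And>d V \<tau>. eigensolution d V \<Longrightarrow> (\<And>z. V (z + 2 * of_real T * \<i>) = \<tau> *s V z) \<Longrightarrow>
    \<tau>\<^sup>2 = exp (\<i> * of_real (2 * (C -
      (Re (integral1 (2 * T)) * d + Im (integral2 (2 * T)) * (- d\<^sup>2 + 2 * energy / 3)))))"
proof (cases "Im S = 0")
  case True
  then show thesis
    using that[of 0] monodromy_square_degenerate by (simp add: integral_parts_degenerate)
next
  case False
  define C where "C = integral3 (2 * T) + Im (integral2 (2 * T)) * (2 * energy / 3)"
  have phase: "C - (Re (integral1 (2 * T)) * d + Im (integral2 (2 * T)) * (- d\<^sup>2 + 2 * energy / 3))
      = integral3 (2 * T) + d\<^sup>2 * Im (integral2 (2 * T)) - d * Re (integral1 (2 * T))" for d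
    by (simp add: C_def algebra_simps)
  show thesis
    by (rule that[of C]) (unfold phase, rule monodromy_square_generic[OF _ _ False])
qed

end

theorem corollary6p3:
  fixes \<psi> lam0 :: complex
    and u :: "real \<Rightarrow> real"
    and T d1 d2 d3 :: real
    and F :: "complex \<Rightarrow> complex^3^3"
    and f :: "complex \<Rightarrow> cp2"
  assumes psi: "\<psi> \<noteq> 0"
    and u_diff: "\<And>y. u differentiable (at y)"
    and u'_diff: "\<And>y. deriv u differentiable (at y)"
    and u_ode: "\<And>y. 1/4 * deriv (deriv u) y + exp (u y) - (cmod \<psi>)\<^sup>2 * exp (- 2 * u y) = 0"
    and u_nonconst: "\<not> u constant_on UNIV"
    and u'_0: "deriv u 0 = 0"
    and u_max: "\<And>y. u y \<le> u 0"
    and T_pos: "T > 0"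
    and period: "\<And>y. u (y + 2 * T) = u y"
    and period_min: "\<And>\<tau>. \<tau> > 0 \<Longrightarrow> (\<And>y. u (y + \<tau>) = u y) \<Longrightarrow> 2 * T \<le> \<tau>"
    and lam0: "cmod lam0 = 1"
    and eigenvalues: "\<And>\<mu>. det (mat \<mu> - potential_D \<psi> u lam0) =
      (\<mu> - \<i> * of_real d1) * (\<mu> - \<i> * of_real d2) * (\<mu> - \<i> * of_real d3)"
    and frame: "is_frame \<psi> u lam0 F"
    and f: "f = surface_of_frame F"
  shows "(equivariant_cylinder real_translations f \<longleftrightarrow> d1 / d2 \<in> \<rat>) \<and>
    (equivariant_cylinder (imaginary_translations T) f \<longleftrightarrow>
      (\<forall>d\<in>{d1, d2}. \<exists>r\<in>\<rat>.
        Re (beta1 \<psi> u lam0 (2 * T)) * d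
          + Im (beta2 \<psi> u lam0 (2 * T)) * (- d\<^sup>2 + 2 * beta \<psi> u / 3) = 2 * pi * r))"
proof -
  define S where "S = lam0 powi (-3) * \<psi>"
  have lam_nonzero: "lam0 \<noteq> 0" and norm_S: "cmod S = cmod \<psi>"
    using lam0 by (auto simp: S_def norm_mult norm_power_int)
  have u_deriv: "(u has_real_derivative deriv u y) (at y)" for y
    using u_diff DERIV_deriv_iff_real_differentiable by blast
  have u'_deriv: "(deriv u has_real_derivative 4 * ((cmod S)\<^sup>2 * exp (- 2 * u y) - exp (u y))) (at y)" for y
  proof -
    have "deriv (deriv u) y = 4 * ((cmod S)\<^sup>2 * exp (- 2 * u y) - exp (u y))"
      using u_ode[of y] norm_S by simp
    moreover have "(deriv u has_real_derivative deriv (deriv u) y) (at y)"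
      using u'_diff DERIV_deriv_iff_real_differentiable by blast
    ultimately show ?thesis
      by simp
  qed
  have nonconst: "\<exists>y. deriv u y \<noteq> 0"
  proof (rule ccontr)
    assume "\<not> (\<exists>y. deriv u y \<noteq> 0)"
    then have "(u has_real_derivative 0) (at y)" for y
      using u_deriv[of y] by simp
    then have "u y = u 0" for y
      using DERIV_isconst_all by blast
    then show False
      using u_nonconst by (auto simp: constant_on_def)
  qed
  interpret periodic_tzitzeica u S T
    by unfold_locales (fact u_deriv u'_deriv T_pos period nonconst)+
  have energy: "beta \<psi> u = energy"
    by (simp add: beta_eq energy_def u'_0 norm_S)
  have "\<mu> ^ 3 + of_real energy * \<mu> - 2 * \<i> * of_real (Re S)
      = (\<mu> - \<i> * of_real d1) * (\<mu> - \<i> * of_real d2) * (\<mu> - \<i> * of_real d3)" for \<mu>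
    using eigenvalues[of \<mu>] by (simp only: det_potential[OF lam0] energy S_def)
  note sym = imaginary_roots_symmetric_functions[OF this]
  have d12: "d1 \<noteq> d2" and d23: "d2 \<noteq> d3" and d13: "d1 \<noteq> d3"
    using eigenvalues_distinct[of d1 d2 d3] eigenvalues_distinct[of d2 d3 d1]
      eigenvalues_distinct[of d3 d1 d2] sym by (simp_all add: ac_simps)

  have cnj_S: "cnj S = lam0 ^ 3 * cnj \<psi>"
  proof -
    have "cnj lam0 = inverse lam0"
      using lam0 by (auto simp: inverse_eq_divide divide_conv_cnj)
    then show ?thesis
      by (simp add: S_def power_int_def)
  qed
  have betas: "beta1 \<psi> u lam0 y = integral1 y" "beta2 \<psi> u lam0 y = integral2 y" for y
    by (simp_all only: beta1_def integral1_def beta2_def integral2_def cnj_S S_def[symmetric]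
        mult.assoc[of _ "lam0 ^ 3"])
  define \<Phi> where "\<Phi> d = Re (beta1 \<psi> u lam0 (2 * T)) * d
    + Im (beta2 \<psi> u lam0 (2 * T)) * (- d\<^sup>2 + 2 * beta \<psi> u / 3)" for d
  obtain C where square: "\<And>d V \<tau>. eigensolution d V \<Longrightarrow>
      (\<And>z. V (z + 2 * of_real T * \<i>) = \<tau> *s V z) \<Longrightarrow> \<tau>\<^sup>2 = exp (\<i> * of_real (2 * (C - \<Phi> d)))"
    using monodromy_square unfolding \<Phi>_def betas energy by blast

  have F: "F 0 = mat 1" and det_F: "det (F z) = 1" for z
    using frame by (auto simp: is_frame_def SU3_def)
  obtain y where y: "deriv u y \<noteq> 0"
    using nonconst by blast
  have ex: "\<exists>w \<tau>. w v* potential_D \<psi> u lam0 = (\<i> * of_real d) *s w \<and> w \<noteq> 0 \<and>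
      eigensolution d (frame_section lam0 F w) \<and>
      (\<forall>z. frame_section lam0 F w (z + 2 * of_real T * \<i>) = \<tau> *s frame_section lam0 F w z)"
    if d: "d \<in> {d1, d2, d3}" for d
  proof -
    have "det (mat (\<i> * of_real d) - potential_D \<psi> u lam0) = 0"
      using d unfolding eigenvalues by auto
    then obtain w where w: "w \<noteq> 0" "w v* (mat (\<i> * of_real d) - potential_D \<psi> u lam0) = 0"
      by (rule left_kernel)
    then have ev: "w v* potential_D \<psi> u lam0 = (\<i> * of_real d) *s w"
      by (simp add: vector_matrix_mult_diff vector_mat_scalar)
    have par: "parallel u S (frame_section lam0 F w)"
      unfolding S_def by (rule parallel_frame_section[OF frame lam0 u_deriv])
    have "lax_x u S (Im 0) (frame_section lam0 F w 0) = (\<i> * of_real d) *s frame_section lam0 F w 0"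
      using frame_section_eigenvector_0[where F = F, OF F lam0 u'_0 ev] by (simp add: S_def)
    note persists = eigen_persists[OF par this]
    have "(d - d1) * (d - d2) * (d - d3) = 0"
      using d by auto
    then have "d ^ 3 - energy * d + 2 * Re S = 0"
      using sym by algebra
    moreover have "frame_section lam0 F w 0 \<noteq> 0"
      using w(1) lam_nonzero by (auto simp: frame_section_def F vec_eq_iff forall_3)
    ultimately have "eigensolution d (frame_section lam0 F w)"
      using par persists by (simp add: eigensolution_def)
    then show ?thesis
      using eigensolution_monodromy w(1) ev by metis
  qed
  obtain w1 \<tau>1 where w1: "w1 v* potential_D \<psi> u lam0 = (\<i> * of_real d1) *s w1" "w1 \<noteq> 0"
    and V1: "eigensolution d1 (frame_section lam0 F w1)"
    and \<tau>1: "\<And>z. frame_section lam0 F w1 (z + 2 * of_real T * \<i>) = \<tau>1 *s frame_section lam0 F w1 z"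
    using ex[of d1] by blast
  obtain w2 \<tau>2 where w2: "w2 v* potential_D \<psi> u lam0 = (\<i> * of_real d2) *s w2" "w2 \<noteq> 0"
    and V2: "eigensolution d2 (frame_section lam0 F w2)"
    and \<tau>2: "\<And>z. frame_section lam0 F w2 (z + 2 * of_real T * \<i>) = \<tau>2 *s frame_section lam0 F w2 z"
    using ex[of d2] by blast
  obtain w3 \<tau>3 where w3: "w3 v* potential_D \<psi> u lam0 = (\<i> * of_real d3) *s w3" "w3 \<noteq> 0"
    and V3: "eigensolution d3 (frame_section lam0 F w3)"
    and \<tau>3: "\<And>z. frame_section lam0 F w3 (z + 2 * of_real T * \<i>) = \<tau>3 *s frame_section lam0 F w3 z"
    using ex[of d3] by blast
  \<comment> \<open>The eigenvalues are distinct, so the three coordinate rows are independent.\<close>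
  have det_W: "det (vector [w1, w2, w3] :: complex^3^3) \<noteq> 0"
    by (rule left_eigenvectors_independent[OF w1(1) w2(1) w3(1) w1(2) w2(2) w3(2)])
      (use d12 d13 d23 in auto)

  have translation: "(\<forall>z. f (z + \<omega>) = f z) \<longleftrightarrow> \<sigma>1 = \<sigma>2 \<and> \<sigma>2 = \<sigma>3"
    if "\<And>z. frame_section lam0 F w1 (z + \<omega>) = \<sigma>1 *s frame_section lam0 F w1 z"
      "\<And>z. frame_section lam0 F w2 (z + \<omega>) = \<sigma>2 *s frame_section lam0 F w2 z"
      "\<And>z. frame_section lam0 F w3 (z + \<omega>) = \<sigma>3 *s frame_section lam0 F w3 z" for \<omega> \<sigma>1 \<sigma>2 \<sigma>3
  proof -
    have third: "(w v* F z) $ 3 = frame_section lam0 F w z $ 3" for w z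
      by (simp add: frame_section_def)
    have generic: "(w v* F (\<i> * of_real y)) $ 3 \<noteq> 0"
      if "eigensolution d (frame_section lam0 F w)" for d w
      unfolding third using eigensolution_third_nonzero[OF that] y by simp
    show ?thesis
      unfolding f
      by (rule surface_translation_iff[where F = F, OF det_F det_W _ _ _ generic[OF V1] generic[OF V2] generic[OF V3]])
        (simp_all add: third that)
  qed

  have "equivariant_cylinder real_translations f \<longleftrightarrow> (\<exists>p. p \<noteq> 0 \<and> (\<forall>z. f (z + of_real p) = f z))"
    by (auto simp: equivariant_cylinder_def real_translations_def)
  also have "\<dots> \<longleftrightarrow> (\<exists>p. p \<noteq> 0 \<and> exp (\<i> * of_real (d1 * p)) = exp (\<i> * of_real (d2 * p))
      \<and> exp (\<i> * of_real (d2 * p)) = exp (\<i> * of_real (d3 * p)))"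
    using translation[OF eigensolution_translate_real[OF V1] eigensolution_translate_real[OF V2]
        eigensolution_translate_real[OF V3]] by simp
  also have "\<dots> \<longleftrightarrow> d1 / d2 \<in> \<rat>"
    by (rule common_phase_iff_rational[OF sym(1) d23])
  finally have real_case: "equivariant_cylinder real_translations f \<longleftrightarrow> d1 / d2 \<in> \<rat>" .

  \<comment> \<open>Compare determinants in \<open>W F(2Ti) = diag (\<tau>\<^sub>1, \<tau>\<^sub>2, \<tau>\<^sub>3) W\<close>, where the rows of \<open>W\<close> are the \<open>w\<^sub>j\<close>.\<close>
  have prod: "\<tau>1 * \<tau>2 * \<tau>3 = 1"
  proof -
    let ?\<omega> = "2 * complex_of_real T * \<i>"
    have shift: "w v* F ?\<omega> = \<tau> *s w"
      if "\<And>z. frame_section lam0 F w (z + ?\<omega>) = \<tau> *s frame_section lam0 F w z" for w \<tau>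
      using that[of 0] frame_section_eq_iff[OF lam_nonzero, of F w ?\<omega> \<tau> F w 0] by (simp add: F)
    have "(vector [w1, w2, w3] :: complex^3^3) ** F ?\<omega> = vector [\<tau>1 *s w1, \<tau>2 *s w2, \<tau>3 *s w3]"
      by (simp only: rows_matrix_mult_3 shift[OF \<tau>1] shift[OF \<tau>2] shift[OF \<tau>3])
    then have "det (vector [w1, w2, w3] :: complex^3^3) * det (F ?\<omega>)
        = \<tau>1 * \<tau>2 * \<tau>3 * det (vector [w1, w2, w3] :: complex^3^3)"
      by (simp only: det_mul[symmetric] det_scaled_rows_3)
    then show ?thesis
      using det_W by (simp add: det_F)
  qed
  have "equivariant_cylinder (imaginary_translations T) f
      \<longleftrightarrow> (\<exists>m::int. m \<noteq> 0 \<and> (\<forall>z. f (z + of_int m * (2 * of_real T * \<i>)) = f z))"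
    using T_pos by (auto simp: equivariant_cylinder_def imaginary_translations_def)
  also have "\<dots> \<longleftrightarrow> (\<exists>m::int. m \<noteq> 0 \<and> \<tau>1 powi m = \<tau>2 powi m \<and> \<tau>2 powi m = \<tau>3 powi m)"
    using translation[OF monodromy_power[OF V1 \<tau>1] monodromy_power[OF V2 \<tau>2] monodromy_power[OF V3 \<tau>3]]
    by simp
  also have "\<dots> \<longleftrightarrow> root_of_unity \<tau>1 \<and> root_of_unity \<tau>2 \<and> root_of_unity \<tau>3"
    by (rule common_power_iff_roots_of_unity[OF prod])
  also have "\<dots> \<longleftrightarrow> \<Phi> d1 / (2 * pi) \<in> \<rat> \<and> \<Phi> d2 / (2 * pi) \<in> \<rat>"
  proof (rule roots_of_unity_iff_phases_rational[OF prod])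
    have "d1\<^sup>2 + d2\<^sup>2 + d3\<^sup>2 = 2 * energy"
      using sym by algebra
    moreover have "\<Phi> d1 + \<Phi> d2 + \<Phi> d3 = Re (beta1 \<psi> u lam0 (2 * T)) * (d1 + d2 + d3)
        + Im (beta2 \<psi> u lam0 (2 * T)) * (2 * energy - (d1\<^sup>2 + d2\<^sup>2 + d3\<^sup>2))"
      by (simp add: \<Phi>_def energy field_simps)
    ultimately show "\<Phi> d1 + \<Phi> d2 + \<Phi> d3 = 0"
      using sym(1) by simp
  qed (rule square[OF V1 \<tau>1] square[OF V2 \<tau>2] square[OF V3 \<tau>3])+
  also have "\<dots> \<longleftrightarrow> (\<forall>d\<in>{d1, d2}. \<exists>r\<in>\<rat>. \<Phi> d = 2 * pi * r)"
  proof -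
    have "x / (2 * pi) \<in> \<rat> \<longleftrightarrow> (\<exists>r\<in>\<rat>. x = 2 * pi * r)" for x
      by (metis nonzero_mult_div_cancel_left mult_eq_0_iff nonzero_eq_divide_eq mult.commute
          pi_neq_zero zero_neq_numeral)
    then show ?thesis
      by simp
  qed
  finally show ?thesis
    using real_case unfolding \<Phi>_def by simp
qed

end
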